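(* Let $I$ be a nonempty finite set, and let $I$ also denote the partition of $I$ into singletons. Consider the linear functors $\pi_I^\vee:\mathsf{Lay}_I^{\mathrm{op}}\to\mathsf{Ass}^\vee_I$ and $\mathcal A_I:\mathsf{Lay}_I\to\mathsf{Lay}_I$, and the contravariant functor $\mathrm{Hom}(-,I)$ on $\mathsf{Ass}_I^\vee$ represented by the zero-dimensional flat $T^\vee[I\text{ into singletons}]=0$ (the action on faces). Identify $\mathrm{Hom}_{\mathsf{Ass}_I^\vee}(T^\vee[P],0)$ with $\mathsf L^\vee[P]$ for each partition $P$ of $I$. For any adjoint face $X$ with semisimple support $T^\vee[Q]$ and any cut $\mathcal V:P\leftarrow Q$, $$X^{\mathcal V}=X\circ\pi_I^\vee(\mathcal V)$$ (composition in $\mathsf{Ass}^\vee_I$). Consequently, for every layered forest $\mathcal F:P\leftarrow Q$, the composite functor $\mathsf{Lay}_I\to\mathsf{Vec}$ obtained from $\pi_I^\vee$ followed by $\mathrm{Hom}(-,I)$ sends $\mathcal F$ to the linear map $\mathsf L^\vee[Q]\to\mathsf L^\vee[P]$, $X\mapsto X^{\mathcal F}$, and the composite functor obtained from $\pi_I^\vee\circ\mathcal A_I$ followed by $\mathrm{Hom}(-,I)$ sends $\mathcal F$ to the dual forest derivative $\boldsymbol\partial_{\mathcal F}^*:\mathsf L^\vee[Q]\to\mathsf L^\vee[P]$.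
   Context: **Arrangement and faces.** $\Bbbk$ is a field of characteristic zero. A partition $P=(S_1|\dots|S_k)$ of $I$ is an unordered set of disjoint nonempty blocks with union $I$; $Q$ is finer than $P$ if every block of $Q$ is contained in a block of $P$ ($Q=P$ allowed). $(I)$ is the one-block partition. Put $T^\vee[P]=\{h\in\mathbb R I:\sum_{i\in S_j}h_i=0 \text{ for all } j\}$ (the "semisimple" flats) and $T^\vee[(I)]$ is the ambient space of the adjoint braid arrangement $\mathrm{Br}^\vee[I]$, whose hyperplanes are $\{\sum_{i\in S}h_i=0\}$, $\emptyset\ne S\subsetneq I$. An adjoint face $X$ is (the characteristic function of) a relatively open face of this arrangement; it is determined by its sign function $s_X$, where $s_X(S)\in\{+,-,0\}$ is the sign of $\sum_{i\in S}h_i$ for $h$ in the face. Its support is its linear span. $\mathsf L^\vee[P]$ is the $\Bbbk$-vector space with basis the adjoint faces with support $T^\vee[P]$. **Forests and the category $\mathsf{Lay}_I$.** A layered forest $\mathcal F:P\leftarrow Q$ is a family of planar full binary trees, one over each block $S_j$ of $P$ with leaves labelled bijectively by the blocks of $Q$ contained in $S_j$, with a linear order on all the (internal) nodes in which each node precedes its descendants. $\mathsf{Lay}_I$ is the $\Bbbk$-linear category with objects the partitions of $I$, $\mathrm{Hom}(Q,P)$ the space of formal linear combinations of layered forests $P\leftarrow Q$, and composition $\mathcal F_1\circ\mathcal F_2:P\leftarrow R$ of $\mathcal F_1:P\leftarrow Q$, $\mathcal F_2:Q\leftarrow R$ given by grafting the trees of $\mathcal F_2$ onto the leaves of $\mathcal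 F_1$, with all nodes of $\mathcal F_1$ preceding those of $\mathcal F_2$. A cut $\mathcal V=[C,D]:P\leftarrow Q$ is a forest with exactly one node, splitting a block $C\sqcup D$ of $P$ into left part $C$ and right part $D$; $\overline{\mathcal V}=[D,C]$. $\mathsf{Lay}_I$ is freely generated by cuts: every layered forest is uniquely $\mathcal F=\mathcal V_1\circ\dots\circ\mathcal V_l$. $\mathcal A_I(\mathcal F)$ is the alternating sum of all layered forests obtained from $\mathcal F$ by switching left and right branches at nodes, with sign the parity of the number of switches. **Derivatives.** For $E\subseteq I$, $\mathrm{Redn}_P(E)$ is $E$ with all blocks of $P$ contained in $E$ removed; $E=S\bmod P$ means $\mathrm{Redn}_P(E)=\mathrm{Redn}_P(S)$. For an adjoint face $X\in\mathsf L^\vee[Q]$ and a cut $\mathcal V=[C,D]:P\leftarrow Q$, $X^{\mathcal V}\in\mathsf L^\vee[P]$ is the adjoint face with sign at $S$ equal to $+$ if $S=C\bmod P$, $-$ if $S=D\bmod P$, $s_X(S)$ if $S\ne\emptyset\bmod Q$, $0$ if $S=\emptyset\bmod P$. For $\mathcal F=\mathcal V_1\circ\dots\circ\mathcal V_l$, $X^{\mathcal F}=((X^{\mathcal V_l})^{\dots})^{\mathcal V_1}$. The dual derivative is $\boldsymbol\partial^*_{\mathcal V}X=X^{\mathcal V}-X^{\overline{\mathcal V}}$, extended linearly, and $\boldsymbol\partial^*_{\mathcal F}=\boldsymbol\partial^*_{\mathcal V_1}\circ\dots\circ\boldsymbol\partial^*_{\mathcal V_l}$. **Category of lunes.** $\mathsf{Ass}_I^\vee$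 is the $\Bbbk$-linearization of the category of lunes of $\mathrm{Br}^\vee[I]$: objects are the flats (intersections of hyperplanes); for flats $B\subseteq A$, a lune with source (case) $A$ and target (base) $B$ is a closed chamber of the arrangement in $A$ formed by the hyperplanes $H\cap A$ of $A$, where $H$ is a hyperplane of $\mathrm{Br}^\vee[I]$ containing $B$ but not $A$. For lunes $M:A\to B$ and $L:B\to C$, $L\circ M:A\to C$ is the unique lune $N$ with case $A$ and base $C$ such that $L\subseteq N\subseteq M$. Lunes with case $T^\vee[P]$ and base $0$ are the closures of the faces with support $T^\vee[P]$; this gives the identification of $\mathrm{Hom}_{\mathsf{Ass}_I^\vee}(T^\vee[P],0)$ with $\mathsf L^\vee[P]$. The functor $\pi_I^\vee$ sends $P$ to $T^\vee[P]$ and a cut $\mathcal V=[C,D]:P\leftarrow Q$ to the closed half-space $\{h\in T^\vee[P]:\sum_{i\in C}h_i\ge0\}$, a lune with case $T^\vee[P]$ and base $T^\vee[Q]$. *)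

theory Defs
  imports
    "HOL-Analysis.Analysis"
    "HOL-Library.Disjoint_Sets"
    "HOL-Library.Poly_Mapping"
begin

text \<open>
  The nonempty finite set \<open>I\<close> is the universe of a type \<open>'i\<close> of class \<open>finite\<close>, so that
  \<open>\<real>I\<close> is \<^typ>\<open>real^'i\<close>, and a partition of \<open>I\<close> is a \<open>P\<close> with \<^prop>\<open>partition_on UNIV P\<close>.
  The vector space over \<open>'k\<close> with basis \<open>B\<close> is the set of all finitely supported
  \<open>p :: 'b \<Rightarrow>\<^sub>0 'k\<close> with \<open>Poly_Mapping.keys p \<subseteq> B\<close>; the basis vector of \<open>b\<close> is \<open>single b 1\<close>.
\<close>

definition lin_ext :: "('a \<Rightarrow> ('b \<Rightarrow>\<^sub>0 'k::field)) \<Rightarrow> ('a \<Rightarrow>\<^sub>0 'k) \<Rightarrow> ('b \<Rightarrow>\<^sub>0 'k)" where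
  "lin_ext f p = (\<Sum>a\<in>Poly_Mapping.keys p. Poly_Mapping.map ((*) (Poly_Mapping.lookup p a)) (f a))"

definition singletons :: "'i set set" where
  "singletons = range (\<lambda>i. {i})"


section \<open>The adjoint braid arrangement\<close>

definition sum_on :: "(real^'i::finite) \<Rightarrow> 'i set \<Rightarrow> real" where
  "sum_on h S = (\<Sum>i\<in>S. h $ i)"

definition T_vee :: "'i set set \<Rightarrow> (real^'i::finite) set" where
  "T_vee P = {h. \<forall>S\<in>P. sum_on h S = 0}"

definition adjoint_hyperplanes :: "(real^'i::finite) set set" where
  "adjoint_hyperplanes =
     {{h \<in> T_vee {UNIV}. sum_on h S = 0} | S. S \<noteq> {} \<and> S \<noteq> UNIV}"

text \<open>The empty intersection is the ambient space.\<close>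

definition adjoint_flats :: "(real^'i::finite) set set" where
  "adjoint_flats = {T_vee {UNIV} \<inter> \<Inter>\<H> | \<H>. \<H> \<subseteq> adjoint_hyperplanes}"

definition adjoint_faces :: "(real^'i::finite) set set" where
  "adjoint_faces =
     {{h' \<in> T_vee {UNIV}. \<forall>S. S \<noteq> {} \<and> S \<noteq> UNIV \<longrightarrow> sgn (sum_on h' S) = sgn (sum_on h S)}
      | h. h \<in> T_vee {UNIV}}"

definition face_sign :: "(real^'i::finite) set \<Rightarrow> 'i set \<Rightarrow> real" where
  "face_sign X S = (THE s. \<forall>h\<in>X. sgn (sum_on h S) = s)"

definition faces_on :: "'i set set \<Rightarrow> (real^'i::finite) set set" where
  "faces_on P = {X \<in> adjoint_faces. span X = T_vee P}"

definition L_vee :: "'i set set \<Rightarrow> ((real^'i::finite) set \<Rightarrow>\<^sub>0 'k::field) set" where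
  "L_vee P = {p. Poly_Mapping.keys p \<subseteq> faces_on P}"


section \<open>Layered forests\<close>

text \<open>
  A linear order on the nodes of a forest is recorded by the rank \<open>0, 1, 2, \<dots>\<close> of each node.
\<close>

datatype 'i layered_tree =
    Leaf "'i set"
  | Node nat "'i layered_tree" "'i layered_tree"

primrec leaves :: "'i layered_tree \<Rightarrow> 'i set list" where
  "leaves (Leaf B) = [B]"
| "leaves (Node n l r) = leaves l @ leaves r"

primrec nodes :: "'i layered_tree \<Rightarrow> nat list" where
  "nodes (Leaf B) = []"
| "nodes (Node n l r) = n # nodes l @ nodes r"

primrec precedes_descendants :: "'i layered_tree \<Rightarrow> bool" where
  "precedes_descendants (Leaf B) = True"
| "precedes_descendants (Node n l r) =
     ((\<forall>m \<in> set (nodes l) \<union> set (nodes r). n < m)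
      \<and> precedes_descendants l \<and> precedes_descendants r)"

definition root_block :: "'i layered_tree \<Rightarrow> 'i set" where
  "root_block t = \<Union>(set (leaves t))"

text \<open>
  Since a tree determines the block it lies over, a family of trees indexed by the blocks of a
  partition is the same as the set of its members.
\<close>

type_synonym 'i forest = "'i layered_tree set"

definition num_nodes :: "'i forest \<Rightarrow> nat" where
  "num_nodes F = (\<Sum>t\<in>F. length (nodes t))"

text \<open>
  \<open>layered_forest P F Q\<close> means \<open>F : P \<leftarrow> Q\<close>. By counting, the last conjunct forces the ranks of
  all nodes, within a tree and across trees, to be distinct.
\<close>

definition layered_forest :: "'i set set \<Rightarrow> 'i forest \<Rightarrow> 'i set set \<Rightarrow> bool" where
  "layered_forest P F Q \<longleftrightarrow>
     partition_on UNIV P \<and> partition_on UNIV Q \<and>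
     bij_betw root_block F P \<and>
     (\<forall>t\<in>F. distinct (leaves t) \<and> set (leaves t) = {B \<in> Q. B \<subseteq> root_block t}
            \<and> precedes_descendants t) \<and>
     (\<Union>t\<in>F. set (nodes t)) = {..<num_nodes F}"

definition tgt :: "'i forest \<Rightarrow> 'i set set" where
  "tgt F = root_block ` F"

definition src :: "'i forest \<Rightarrow> 'i set set" where
  "src F = (\<Union>t\<in>F. set (leaves t))"

primrec shift_ranks :: "nat \<Rightarrow> 'i layered_tree \<Rightarrow> 'i layered_tree" where
  "shift_ranks k (Leaf B) = Leaf B"
| "shift_ranks k (Node n l r) = Node (k + n) (shift_ranks k l) (shift_ranks k r)"

definition tree_over :: "'i forest \<Rightarrow> 'i set \<Rightarrow> 'i layered_tree" where
  "tree_over F B = (THE t. t \<in> F \<and> root_block t = B)"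

primrec graft :: "nat \<Rightarrow> 'i forest \<Rightarrow> 'i layered_tree \<Rightarrow> 'i layered_tree" where
  "graft k G (Leaf B) = shift_ranks k (tree_over G B)"
| "graft k G (Node n l r) = Node n (graft k G l) (graft k G r)"

definition forest_comp :: "'i forest \<Rightarrow> 'i forest \<Rightarrow> 'i forest" where
  "forest_comp F G = graft (num_nodes F) G ` F"

definition forest_id :: "'i set set \<Rightarrow> 'i forest" where
  "forest_id Q = Leaf ` Q"


subsection \<open>Cuts\<close>

definition cut :: "'i set set \<Rightarrow> 'i set \<Rightarrow> 'i set \<Rightarrow> 'i forest" where
  "cut P C D = insert (Node 0 (Leaf C) (Leaf D)) (Leaf ` (P - {C \<union> D}))"

definition is_cut :: "'i set set \<Rightarrow> 'i forest \<Rightarrow> 'i set set \<Rightarrow> bool" where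
  "is_cut P V Q \<longleftrightarrow> layered_forest P V Q \<and> num_nodes V = 1"

definition left_part :: "'i forest \<Rightarrow> 'i set" where
  "left_part V = (THE C. \<exists>D. Node 0 (Leaf C) (Leaf D) \<in> V)"

definition right_part :: "'i forest \<Rightarrow> 'i set" where
  "right_part V = (THE D. \<exists>C. Node 0 (Leaf C) (Leaf D) \<in> V)"

definition cut_bar :: "'i forest \<Rightarrow> 'i forest" where
  "cut_bar V = cut (tgt V) (right_part V) (left_part V)"

primrec cut_chain :: "'i set set \<Rightarrow> 'i forest list \<Rightarrow> 'i set set \<Rightarrow> bool" where
  "cut_chain P [] Q \<longleftrightarrow> P = Q"
| "cut_chain P (V # Vs) Q \<longleftrightarrow> (\<exists>R. is_cut P V R \<and> cut_chain R Vs Q)"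

text \<open>The unique factorization \<open>F = V\<^sub>1 \<circ> \<dots> \<circ> V\<^sub>l\<close> into cuts; the empty composite is an identity.\<close>

definition cuts_of :: "'i forest \<Rightarrow> 'i forest list" where
  "cuts_of F =
     (THE Vs. cut_chain (tgt F) Vs (src F) \<and> foldr forest_comp Vs (forest_id (src F)) = F)"


subsection \<open>The functor \<open>\<A>\<^sub>I\<close>\<close>

text \<open>Switch left and right branches at the nodes whose rank lies in \<open>W\<close>.\<close>

primrec switch :: "nat set \<Rightarrow> 'i layered_tree \<Rightarrow> 'i layered_tree" where
  "switch W (Leaf B) = Leaf B"
| "switch W (Node n l r) =
     (if n \<in> W then Node n (switch W r) (switch W l) else Node n (switch W l) (switch W r))"

definition alternating_forest :: "'i forest \<Rightarrow> ('i forest \<Rightarrow>\<^sub>0 'k::field)" where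
  "alternating_forest F =
     (\<Sum>W\<in>Pow {..<num_nodes F}. Poly_Mapping.single (switch W ` F) ((- 1) ^ card W))"

definition A_functor :: "('i forest \<Rightarrow>\<^sub>0 'k::field) \<Rightarrow> ('i forest \<Rightarrow>\<^sub>0 'k)" where
  "A_functor = lin_ext alternating_forest"


section \<open>Derivatives of adjoint faces\<close>

definition Redn :: "'i set set \<Rightarrow> 'i set \<Rightarrow> 'i set" where
  "Redn P E = E - \<Union>{B \<in> P. B \<subseteq> E}"

definition eq_mod :: "'i set set \<Rightarrow> 'i set \<Rightarrow> 'i set \<Rightarrow> bool" where
  "eq_mod P S E \<longleftrightarrow> Redn P S = Redn P E"

definition cut_deriv :: "'i forest \<Rightarrow> (real^'i::finite) set \<Rightarrow> (real^'i) set" where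
  "cut_deriv V X =
     (THE Y. Y \<in> faces_on (tgt V) \<and>
       (\<forall>S. (eq_mod (tgt V) S (left_part V) \<longrightarrow> face_sign Y S = 1) \<and>
            (eq_mod (tgt V) S (right_part V) \<longrightarrow> face_sign Y S = - 1) \<and>
            (\<not> eq_mod (src V) S {} \<longrightarrow> face_sign Y S = face_sign X S) \<and>
            (eq_mod (tgt V) S {} \<longrightarrow> face_sign Y S = 0)))"

definition forest_deriv :: "'i forest \<Rightarrow> (real^'i::finite) set \<Rightarrow> (real^'i) set" where
  "forest_deriv F X = foldr cut_deriv (cuts_of F) X"

definition forest_deriv_map ::
    "'i forest \<Rightarrow> ((real^'i::finite) set \<Rightarrow>\<^sub>0 'k::field) \<Rightarrow> ((real^'i) set \<Rightarrow>\<^sub>0 'k)" where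
  "forest_deriv_map F = lin_ext (\<lambda>X. Poly_Mapping.single (forest_deriv F X) 1)"

definition dual_cut_deriv ::
    "'i forest \<Rightarrow> ((real^'i::finite) set \<Rightarrow>\<^sub>0 'k::field) \<Rightarrow> ((real^'i) set \<Rightarrow>\<^sub>0 'k)" where
  "dual_cut_deriv V =
     lin_ext (\<lambda>X. Poly_Mapping.single (cut_deriv V X) 1
                 - Poly_Mapping.single (cut_deriv (cut_bar V) X) 1)"

definition dual_forest_deriv ::
    "'i forest \<Rightarrow> ((real^'i::finite) set \<Rightarrow>\<^sub>0 'k::field) \<Rightarrow> ((real^'i) set \<Rightarrow>\<^sub>0 'k)" where
  "dual_forest_deriv F = foldr dual_cut_deriv (cuts_of F)"


section \<open>The category of lunes\<close>

text \<open>\<open>lunes A B\<close> is the set of lunes with case (source) \<open>A\<close> and base (target) \<open>B\<close>.\<close>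

definition lunes :: "(real^'i::finite) set \<Rightarrow> (real^'i) set \<Rightarrow> (real^'i) set set" where
  "lunes A B =
     {closure K | K. A \<in> adjoint_flats \<and> B \<in> adjoint_flats \<and> B \<subseteq> A \<and>
        K \<in> components (A - \<Union>{H \<inter> A | H. H \<in> adjoint_hyperplanes \<and> B \<subseteq> H \<and> \<not> A \<subseteq> H})}"

text \<open>\<open>lune_comp A C L M\<close> is \<open>L \<circ> M : A \<rightarrow> C\<close> for \<open>M : A \<rightarrow> B\<close> and \<open>L : B \<rightarrow> C\<close>.\<close>

definition lune_comp ::
    "(real^'i::finite) set \<Rightarrow> (real^'i) set \<Rightarrow> (real^'i) set \<Rightarrow> (real^'i) set \<Rightarrow> (real^'i) set" where
  "lune_comp A C L M = (THE N. N \<in> lunes A C \<and> L \<subseteq> N \<and> N \<subseteq> M)"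

definition Ass_hom ::
    "(real^'i::finite) set \<Rightarrow> (real^'i) set \<Rightarrow> ((real^'i) set \<Rightarrow>\<^sub>0 'k::field) set" where
  "Ass_hom A B = {f. Poly_Mapping.keys f \<subseteq> lunes A B}"

definition Ass_comp ::
    "(real^'i::finite) set \<Rightarrow> (real^'i) set \<Rightarrow>
     ((real^'i) set \<Rightarrow>\<^sub>0 'k::field) \<Rightarrow> ((real^'i) set \<Rightarrow>\<^sub>0 'k) \<Rightarrow> ((real^'i) set \<Rightarrow>\<^sub>0 'k)" where
  "Ass_comp A C g f =
     lin_ext (\<lambda>L. lin_ext (\<lambda>M. Poly_Mapping.single (lune_comp A C L M) 1) f) g"


subsection \<open>The functor \<open>\<pi>\<^sub>I\<close>\<close>

definition half_space :: "'i forest \<Rightarrow> (real^'i::finite) set" where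
  "half_space V = {h \<in> T_vee (tgt V). sum_on h (left_part V) \<ge> 0}"

text \<open>
  \<open>\<pi>(V\<^sub>1 \<circ> \<dots> \<circ> V\<^sub>l) = \<pi>(V\<^sub>l) \<circ> \<dots> \<circ> \<pi>(V\<^sub>1)\<close> for composable cuts with final source \<open>Q\<close>. The lune from
  a flat to itself, the identity, is the flat.
\<close>

primrec pi_cuts :: "'i set set \<Rightarrow> 'i forest list \<Rightarrow> (real^'i::finite) set" where
  "pi_cuts Q [] = T_vee Q"
| "pi_cuts Q (V # Vs) = lune_comp (T_vee (tgt V)) (T_vee Q) (pi_cuts Q Vs) (half_space V)"

definition pi_forest :: "'i forest \<Rightarrow> (real^'i::finite) set" where
  "pi_forest F = pi_cuts (src F) (cuts_of F)"

definition pi_functor :: "('i forest \<Rightarrow>\<^sub>0 'k::field) \<Rightarrow> ((real^'i::finite) set \<Rightarrow>\<^sub>0 'k)" where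
  "pi_functor = lin_ext (\<lambda>F. Poly_Mapping.single (pi_forest F) 1)"


subsection \<open>The functor represented by the zero flat\<close>

text \<open>A morphism \<open>f : A \<rightarrow> B\<close> acts as \<open>Hom(B, 0) \<rightarrow> Hom(A, 0)\<close> by \<open>x \<mapsto> x \<circ> f\<close>.\<close>

definition Hom_zero ::
    "(real^'i::finite) set \<Rightarrow> ((real^'i) set \<Rightarrow>\<^sub>0 'k::field) \<Rightarrow>
     ((real^'i) set \<Rightarrow>\<^sub>0 'k) \<Rightarrow> ((real^'i) set \<Rightarrow>\<^sub>0 'k)" where
  "Hom_zero A f x = Ass_comp A (T_vee singletons) x f"

text \<open>The identification of \<^term>\<open>L_vee P\<close> with \<^term>\<open>Ass_hom (T_vee P) (T_vee singletons)\<close>.\<close>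

definition face_lune :: "((real^'i::finite) set \<Rightarrow>\<^sub>0 'k::field) \<Rightarrow> ((real^'i) set \<Rightarrow>\<^sub>0 'k)" where
  "face_lune = lin_ext (\<lambda>X. Poly_Mapping.single (closure X) 1)"

end

theory Submission
  imports Defs
begin

text \<open>
  A lune \<open>A \<rightarrow> B\<close> is the closed cone cut out of \<open>A\<close> by the signs, at a generic point of \<open>A\<close>, of the
  functionals \<open>h \<mapsto> \<Sum>\<^sub>S h\<close> that vanish on \<open>B\<close>. In these terms \<open>L \<circ> M\<close> takes the signs of \<open>M\<close> at the
  functionals vanishing on the intermediate flat and the signs of \<open>L\<close> at the others, so composition
  is associative. For \<open>M\<close> the half-space of a cut \<open>[C, D]\<close> this is the rule that defines
  \<open>X\<^sup>V\<close>, since the \<open>S\<close> that vanish on the intermediate flat are those with \<open>S = \<emptyset>, C, D mod P\<close>.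
  Iterating over the factorization of a forest into cuts gives the forest derivative. Switching
  branches replaces some of the cuts \<open>V\<close> of that factorization by their opposites, and expanding
  the composite of the operators \<open>X\<^sup>V - X\<^bsup>cut_bar V\<^esup>\<close> produces the same alternating sum.
\<close>

section \<open>Linear extension\<close>

text \<open>Composites of lunes, cut derivatives and factorizations are all given by definite
  descriptions, so each of them calls for an existence and a uniqueness argument. For lunes and
  faces both run through one generic point: existence exhibits such a point, and uniqueness compares
  signs, where a weak inequality between two nonzero numbers already forces equal signs. Genericity
  takes care of the zeros: a functional from the relevant family that vanishes at the point vanishes
  on the whole flat. For forests the cut to split off is the node of rank 0. It has to be a root, it
  is adjacent to the target partition, and removing it lowers all other ranks by one, which matches
  the recursion of a right fold over the list of cuts.\<close>

lemma lookup_map_mult [simp]: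
  "Poly_Mapping.lookup (Poly_Mapping.map ((*) c) q) b = (c::'k::field) * Poly_Mapping.lookup q b"
  by (simp add: map.rep_eq when_def)

text \<open>Cancellation can shrink the support of a sum or of a multiple; a free index set
  \<open>K\<close> lets both sides of an identity be summed over the same keys.\<close>

lemma lookup_lin_ext:
  assumes "finite K" "Poly_Mapping.keys p \<subseteq> K"
  shows "Poly_Mapping.lookup (lin_ext f p) b =
    (\<Sum>a\<in>K. Poly_Mapping.lookup p a * Poly_Mapping.lookup (f a) b)"
proof -
  have "Poly_Mapping.lookup (lin_ext f p) b =
      (\<Sum>a\<in>Poly_Mapping.keys p. Poly_Mapping.lookup p a * Poly_Mapping.lookup (f a) b)"
    by (simp add: lin_ext_def lookup_sum)
  also have "\<dots> = (\<Sum>a\<in>K. Poly_Mapping.lookup p a * Poly_Mapping.lookup (f a) b)"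
    using assms by (intro sum.mono_neutral_left) (auto simp: in_keys_iff)
  finally show ?thesis .
qed

lemma lin_ext_single [simp]: "lin_ext f (Poly_Mapping.single a c) = Poly_Mapping.map ((*) c) (f a)"
  by (rule poly_mapping_eqI, subst lookup_lin_ext[where K="{a}"]) (auto split: if_splits)

lemma map_mult_one [simp]: "Poly_Mapping.map ((*) (1::'k::field)) q = q"
  by (rule poly_mapping_eqI) simp

lemma map_mult_single [simp]:
  "Poly_Mapping.map ((*) c) (Poly_Mapping.single a d) = Poly_Mapping.single a ((c::'k::field) * d)"
  by (rule poly_mapping_eqI) (simp add: lookup_single when_def)

lemma lin_ext_zero [simp]: "lin_ext f 0 = 0"
  by (simp add: lin_ext_def)

lemma lin_ext_add: "lin_ext f (p + q) = lin_ext f p + lin_ext f q"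
proof (rule poly_mapping_eqI)
  fix b
  let ?K = "Poly_Mapping.keys p \<union> Poly_Mapping.keys q"
  have "Poly_Mapping.keys (p + q) \<subseteq> ?K" by (rule keys_add)
  then show "Poly_Mapping.lookup (lin_ext f (p + q)) b = Poly_Mapping.lookup (lin_ext f p + lin_ext f q) b"
    by (simp add: lookup_add lookup_lin_ext[where K="?K"] sum.distrib algebra_simps)
qed

lemma lin_ext_map_mult:
  "lin_ext f (Poly_Mapping.map ((*) c) p) = Poly_Mapping.map ((*) c) (lin_ext f p)"
proof (rule poly_mapping_eqI)
  fix b
  have "Poly_Mapping.keys (Poly_Mapping.map ((*) c) p) \<subseteq> Poly_Mapping.keys p"
    by (auto simp: in_keys_iff)
  then show "Poly_Mapping.lookup (lin_ext f (Poly_Mapping.map ((*) c) p)) b =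
      Poly_Mapping.lookup (Poly_Mapping.map ((*) c) (lin_ext f p)) b"
    by (simp add: lookup_lin_ext[where K="Poly_Mapping.keys p"] sum_distrib_left algebra_simps)
qed

lemma lin_ext_sum: "lin_ext f (\<Sum>a\<in>A. p a) = (\<Sum>a\<in>A. lin_ext f (p a))"
  by (induction A rule: infinite_finite_induct) (simp_all add: lin_ext_add)

lemma lin_ext_cong:
  assumes "\<And>a. a \<in> Poly_Mapping.keys p \<Longrightarrow> f a = g a"
  shows "lin_ext f p = lin_ext g p"
  using assms by (simp add: lin_ext_def)

lemma lin_ext_lin_ext: "lin_ext g (lin_ext f p) = lin_ext (\<lambda>a. lin_ext g (f a)) p"
  by (simp add: lin_ext_def[of f] lin_ext_sum lin_ext_map_mult lin_ext_def[of "\<lambda>a. lin_ext g (f a)"])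

lemma lin_ext_single_one [simp]: "lin_ext (\<lambda>a. Poly_Mapping.single a 1) p = p"
  by (rule poly_mapping_eqI, subst lookup_lin_ext[OF finite_keys subset_refl])
    (auto simp: lookup_single when_def in_keys_iff sum.delta' if_distrib cong: if_cong)

lemma keys_lin_ext:
  assumes "\<And>a. a \<in> Poly_Mapping.keys p \<Longrightarrow> Poly_Mapping.keys (f a) \<subseteq> B"
  shows "Poly_Mapping.keys (lin_ext f p) \<subseteq> B"
proof
  fix b assume "b \<in> Poly_Mapping.keys (lin_ext f p)"
  then have "(\<Sum>a\<in>Poly_Mapping.keys p. Poly_Mapping.lookup p a * Poly_Mapping.lookup (f a) b) \<noteq> 0"
    using lookup_lin_ext[OF finite_keys subset_refl, of f p b] by (simp add: in_keys_iff)
  then obtain a where "a \<in> Poly_Mapping.keys p" "Poly_Mapping.lookup (f a) b \<noteq> 0"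
    by (rule sum.not_neutral_contains_not_neutral) auto
  then show "b \<in> B" using assms[of a] by (meson in_keys_iff subsetD)
qed

text \<open>A bijection between bases induces one between the free spaces. Values of
  \<open>inv_into\<close> outside \<open>B\<close> never enter, because the supports stay inside
  \<open>B\<close>.\<close>

lemma lin_ext_single_bij_betw:
  assumes "bij_betw g A B"
  shows "bij_betw (lin_ext (\<lambda>a. Poly_Mapping.single (g a) (1::'k::field)))
    {p. Poly_Mapping.keys p \<subseteq> A} {q. Poly_Mapping.keys q \<subseteq> B}"
proof (rule bij_betw_byWitness[where f' = "lin_ext (\<lambda>b. Poly_Mapping.single (inv_into A g b) 1)"])
  have inv: "\<And>a. a \<in> A \<Longrightarrow> inv_into A g (g a) = a" "\<And>b. b \<in> B \<Longrightarrow> g (inv_into A g b) = b"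
    "\<And>a. a \<in> A \<Longrightarrow> g a \<in> B" "\<And>b. b \<in> B \<Longrightarrow> inv_into A g b \<in> A"
    using assms bij_betw_inv_into_left bij_betw_inv_into_right bij_betwE bij_betw_inv_into
    by metis+
  show "\<forall>p\<in>{p. Poly_Mapping.keys p \<subseteq> A}.
      lin_ext (\<lambda>b. Poly_Mapping.single (inv_into A g b) 1)
        (lin_ext (\<lambda>a. Poly_Mapping.single (g a) (1::'k)) p) = p"
  proof safe
    fix p :: "'a \<Rightarrow>\<^sub>0 'k" assume "Poly_Mapping.keys p \<subseteq> A"
    then have "lin_ext (\<lambda>a. Poly_Mapping.single (inv_into A g (g a)) 1) p =
        lin_ext (\<lambda>a. Poly_Mapping.single a 1) p"
      by (intro lin_ext_cong) (metis inv(1) subsetD)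
    then show "lin_ext (\<lambda>b. Poly_Mapping.single (inv_into A g b) 1)
        (lin_ext (\<lambda>a. Poly_Mapping.single (g a) (1::'k)) p) = p"
      by (simp add: lin_ext_lin_ext)
  qed
  show "\<forall>q\<in>{q. Poly_Mapping.keys q \<subseteq> B}.
      lin_ext (\<lambda>a. Poly_Mapping.single (g a) 1)
        (lin_ext (\<lambda>b. Poly_Mapping.single (inv_into A g b) (1::'k)) q) = q"
  proof safe
    fix q :: "'b \<Rightarrow>\<^sub>0 'k" assume "Poly_Mapping.keys q \<subseteq> B"
    then have "lin_ext (\<lambda>b. Poly_Mapping.single (g (inv_into A g b)) 1) q =
        lin_ext (\<lambda>b. Poly_Mapping.single b 1) q"
      by (intro lin_ext_cong) (metis inv(2) subsetD)
    then show "lin_ext (\<lambda>a. Poly_Mapping.single (g a) 1)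
        (lin_ext (\<lambda>b. Poly_Mapping.single (inv_into A g b) (1::'k)) q) = q"
      by (simp add: lin_ext_lin_ext)
  qed
  show "lin_ext (\<lambda>a. Poly_Mapping.single (g a) (1::'k)) ` {p. Poly_Mapping.keys p \<subseteq> A}
      \<subseteq> {q. Poly_Mapping.keys q \<subseteq> B}"
  proof safe
    fix p :: "'a \<Rightarrow>\<^sub>0 'k" and b
    assume "Poly_Mapping.keys p \<subseteq> A"
      "b \<in> Poly_Mapping.keys (lin_ext (\<lambda>a. Poly_Mapping.single (g a) (1::'k)) p)"
    then show "b \<in> B"
      using keys_lin_ext[of p "\<lambda>a. Poly_Mapping.single (g a) 1" B] inv(3) by auto
  qed
  show "lin_ext (\<lambda>b. Poly_Mapping.single (inv_into A g b) (1::'k)) ` {q. Poly_Mapping.keys q \<subseteq> B}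
      \<subseteq> {p. Poly_Mapping.keys p \<subseteq> A}"
  proof safe
    fix q :: "'b \<Rightarrow>\<^sub>0 'k" and a
    assume "Poly_Mapping.keys q \<subseteq> B"
      "a \<in> Poly_Mapping.keys (lin_ext (\<lambda>b. Poly_Mapping.single (inv_into A g b) (1::'k)) q)"
    then show "a \<in> A"
      using keys_lin_ext[of q "\<lambda>b. Poly_Mapping.single (inv_into A g b) 1" A] inv(4) by auto
  qed
qed

section \<open>Sign cells\<close>

lemma sum_on_add: "sum_on (x + y) S = sum_on x S + sum_on y S"
  by (simp add: sum_on_def sum.distrib)

lemma sum_on_scaleR: "sum_on (c *\<^sub>R x) S = c * sum_on x S"
  by (simp add: sum_on_def sum_distrib_left)

lemma sum_on_zero [simp]: "sum_on 0 S = 0"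
  by (simp add: sum_on_def)

lemma sum_on_empty [simp]: "sum_on h {} = 0"
  by (simp add: sum_on_def)

lemma linear_sum_on: "linear (\<lambda>h. sum_on h S)"
  by (rule linearI) (simp_all add: sum_on_add sum_on_scaleR)

lemma continuous_on_sum_on: "continuous_on A (\<lambda>h. sum_on h S)"
  by (rule linear_continuous_on_compose[OF continuous_on_id linear_sum_on, simplified])

lemma sum_on_diff: "S' \<subseteq> S \<Longrightarrow> sum_on h (S - S') = sum_on h S - sum_on h (S' :: 'i::finite set)"
  unfolding sum_on_def by (rule sum_diff) auto

lemma sum_on_Union:
  assumes "disjoint \<S>"
  shows "sum_on h (\<Union>\<S>) = (\<Sum>S\<in>\<S>. sum_on h (S :: 'i::finite set))"
  unfolding sum_on_def using assms
  by (subst sum.Union_disjoint) (auto simp: disjoint_def)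

section \<open>Signs relative to a pair of nested flats\<close>

text \<open>For a flat this indexes the hyperplanes through it. The sets \<open>{}\<close> and
  \<open>UNIV\<close> index no hyperplane, but their sums vanish on the whole ambient space, so
  admitting them adds no condition there and frees later quantifiers from exceptions.\<close>

definition vanishing :: "(real^'i::finite) set \<Rightarrow> 'i set set" where
  "vanishing A = {S. \<forall>h\<in>A. sum_on h S = 0}"

text \<open>For flats: the points of \<open>A\<close> off all hyperplanes that contain
  \<open>B\<close> but not \<open>A\<close>, hence the union of the open chambers whose closures are
  the lunes.\<close>

definition generic :: "(real^'i::finite) set \<Rightarrow> (real^'i) set \<Rightarrow> real^'i \<Rightarrow> bool" where
  "generic A B m \<longleftrightarrow> m \<in> A \<and> (\<forall>S\<in>vanishing B. sum_on m S = 0 \<longrightarrow> S \<in> vanishing A)"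

definition sign_cell :: "(real^'i::finite) set \<Rightarrow> (real^'i) set \<Rightarrow> real^'i \<Rightarrow> (real^'i) set" where
  "sign_cell A B m = {h\<in>A. \<forall>S\<in>vanishing B. sgn (sum_on h S) = sgn (sum_on m S)}"

text \<open>Where \<open>sum_on m S\<close> is zero the inequality is void rather than an equation.
  For generic \<open>m\<close> nothing is lost, since the sum over such an \<open>S\<close> vanishes
  on all of \<open>A\<close>.\<close>

definition sign_cone :: "(real^'i::finite) set \<Rightarrow> (real^'i) set \<Rightarrow> real^'i \<Rightarrow> (real^'i) set" where
  "sign_cone A B m = {h\<in>A. \<forall>S\<in>vanishing B. 0 \<le> sgn (sum_on m S) * sum_on h S}"

lemma vanishing_antimono: "B \<subseteq> A \<Longrightarrow> vanishing A \<subseteq> vanishing B"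
  by (auto simp: vanishing_def)

lemma vanishingD: "S \<in> vanishing A \<Longrightarrow> h \<in> A \<Longrightarrow> sum_on h S = 0"
  by (simp add: vanishing_def)

lemma genericI:
  assumes "m \<in> A" "\<And>S. S \<in> vanishing B \<Longrightarrow> sum_on m S = 0 \<Longrightarrow> S \<in> vanishing A"
  shows "generic A B m"
  using assms by (simp add: generic_def)

lemma generic_mem: "generic A B m \<Longrightarrow> m \<in> A"
  by (simp add: generic_def)

lemma generic_vanishing:
  "generic A B m \<Longrightarrow> S \<in> vanishing B \<Longrightarrow> sum_on m S = 0 \<Longrightarrow> S \<in> vanishing A"
  by (simp add: generic_def)

lemma generic_mem_sign_cell: "generic A B m \<Longrightarrow> m \<in> sign_cell A B m"
  by (simp add: generic_def sign_cell_def)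

lemma generic_mem_sign_cone: "generic A B m \<Longrightarrow> m \<in> sign_cone A B m"
  by (auto simp: generic_def sign_cone_def sgn_mult_self_eq sgn_if)

lemma sign_cone_cong:
  assumes "\<And>S. S \<in> vanishing B \<Longrightarrow> sgn (sum_on m S) = sgn (sum_on n S)"
  shows "sign_cone A B m = sign_cone A B n"
  using assms by (auto simp: sign_cone_def)

lemma sign_cell_cong:
  assumes "\<And>S. S \<in> vanishing B \<Longrightarrow> sgn (sum_on m S) = sgn (sum_on n S)"
  shows "sign_cell A B m = sign_cell A B n"
  using assms by (auto simp: sign_cell_def)

text \<open>Only finitely many subsets exist, so one step length can keep the perturbation below
  every nonzero sum of \<open>l\<close>.\<close>

lemma sgn_add_small_multiple:
  fixes l h :: "real^'i::finite"
  obtains e where "0 < e"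
    "\<And>S. sum_on l S \<noteq> 0 \<Longrightarrow> sgn (sum_on (l + e *\<^sub>R h) S) = sgn (sum_on l S)"
proof -
  have "\<exists>e>0. \<forall>S\<in>F. sum_on l S \<noteq> 0 \<longrightarrow> e * \<bar>sum_on h S\<bar> < \<bar>sum_on l S\<bar>" if "finite F" for F
    using that
  proof (induction F)
    case empty
    then show ?case by (auto intro: exI[of _ 1])
  next
    case (insert S F)
    then obtain e where e: "e > 0" "\<forall>S\<in>F. sum_on l S \<noteq> 0 \<longrightarrow> e * \<bar>sum_on h S\<bar> < \<bar>sum_on l S\<bar>"
      by blast
    \<comment> \<open>The \<open>+ 1\<close> keeps the denominator positive and the resulting bound
      strict, also when \<open>sum_on h S\<close> is zero.\<close>
    define d where "d = (if sum_on l S = 0 then 1 else \<bar>sum_on l S\<bar> / (\<bar>sum_on h S\<bar> + 1))"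
    have d: "d > 0" by (simp add: d_def add_nonneg_pos)
    have dS: "sum_on l S \<noteq> 0 \<longrightarrow> d * \<bar>sum_on h S\<bar> < \<bar>sum_on l S\<bar>"
    proof
      assume "sum_on l S \<noteq> 0"
      then have "d * (\<bar>sum_on h S\<bar> + 1) = \<bar>sum_on l S\<bar>"
        by (simp add: d_def add_nonneg_eq_0_iff)
      then show "d * \<bar>sum_on h S\<bar> < \<bar>sum_on l S\<bar>" using d by (simp add: algebra_simps)
    qed
    have "min d e * \<bar>sum_on h T\<bar> \<le> d * \<bar>sum_on h T\<bar>" "min d e * \<bar>sum_on h T\<bar> \<le> e * \<bar>sum_on h T\<bar>" for T
      by (auto intro: mult_right_mono)
    then show ?case using e d dS
      by (intro exI[of _ "min d e"]) (auto intro: order.strict_trans1)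
  qed
  from this[of UNIV] obtain e where e: "e > 0"
    "\<And>S. sum_on l S \<noteq> 0 \<Longrightarrow> e * \<bar>sum_on h S\<bar> < \<bar>sum_on l S\<bar>" by auto
  have "sgn (sum_on (l + e *\<^sub>R h) S) = sgn (sum_on l S)" if "sum_on l S \<noteq> 0" for S
  proof -
    have "\<bar>e * sum_on h S\<bar> < \<bar>sum_on l S\<bar>" using e(2)[OF that] e(1) by (simp add: abs_mult)
    then show ?thesis by (simp add: sum_on_add sum_on_scaleR sgn_if) linarith
  qed
  with e(1) show ?thesis by (rule that)
qed

section \<open>Flats as linear subspaces\<close>

lemma subspace_T_vee: "subspace (T_vee P)"
  by (auto simp: T_vee_def subspace_def sum_on_add sum_on_scaleR)

lemma T_vee_flat:
  assumes "partition_on UNIV (P :: 'i::finite set set)"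
  shows "T_vee P \<in> adjoint_flats"
proof -
  \<comment> \<open>The block \<open>UNIV\<close> indexes no hyperplane. It occurs only in the
    one-block partition, whose flat is the ambient space, that is, the empty intersection.\<close>
  let ?H = "(\<lambda>S. {h \<in> T_vee {UNIV}. sum_on h S = 0}) ` (P - {UNIV})"
  have "sum_on h UNIV = 0" if "\<forall>S\<in>P. sum_on h S = 0" for h :: "real^'i"
  proof -
    have "sum_on h (\<Union>P) = 0"
      using that assms by (subst sum_on_Union) (auto simp: partition_on_def)
    then show ?thesis using assms by (simp add: partition_on_def)
  qed
  then have "T_vee P = T_vee {UNIV} \<inter> \<Inter>?H"
    by (auto simp: T_vee_def)
  moreover have "?H \<subseteq> adjoint_hyperplanes"
    using assms by (auto simp: adjoint_hyperplanes_def partition_on_def)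
  ultimately show ?thesis unfolding adjoint_flats_def by blast
qed

lemma flat_subspace:
  assumes "A \<in> adjoint_flats"
  shows "subspace A"
proof -
  obtain \<H> where \<H>: "A = T_vee {UNIV} \<inter> \<Inter>\<H>" "\<H> \<subseteq> adjoint_hyperplanes"
    using assms by (auto simp: adjoint_flats_def)
  have "subspace H" if "H \<in> \<H>" for H
    using that \<H>(2) by (auto simp: adjoint_hyperplanes_def T_vee_def subspace_def sum_on_add sum_on_scaleR)
  then show ?thesis unfolding \<H>(1) by (intro subspace_inter subspace_T_vee subspace_Inter) auto
qed

lemma flat_subset_ambient: "A \<in> adjoint_flats \<Longrightarrow> A \<subseteq> T_vee {UNIV}"
  by (auto simp: adjoint_flats_def)

lemma UNIV_vanishing: "A \<subseteq> T_vee {UNIV} \<Longrightarrow> UNIV \<in> vanishing A"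
  by (auto simp: vanishing_def T_vee_def)

lemma subspace_add_scaleR: "subspace A \<Longrightarrow> x \<in> A \<Longrightarrow> y \<in> A \<Longrightarrow> x + c *\<^sub>R y \<in> A"
  by (simp add: subspace_add subspace_scale)

section \<open>Lunes as closures of sign cells\<close>

lemma arrangement_complement_eq:
  assumes "A \<in> adjoint_flats" "B \<subseteq> A"
  shows "A - \<Union>{H \<inter> A | H. H \<in> adjoint_hyperplanes \<and> B \<subseteq> H \<and> \<not> A \<subseteq> H} =
    {m. generic A B m}"
proof -
  have A: "A \<subseteq> T_vee {UNIV}" using assms(1) by (rule flat_subset_ambient)
  have eq: "generic A B m \<longleftrightarrow> m \<in> A \<and>
      (\<forall>H. H \<in> adjoint_hyperplanes \<and> B \<subseteq> H \<and> \<not> A \<subseteq> H \<longrightarrow> m \<notin> H)" for m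
  proof (intro iffI conjI allI impI)
    assume g: "generic A B m"
    then show "m \<in> A" by (rule generic_mem)
    fix H assume H: "H \<in> adjoint_hyperplanes \<and> B \<subseteq> H \<and> \<not> A \<subseteq> H"
    then obtain S where S: "H = {h \<in> T_vee {UNIV}. sum_on h S = 0}"
      by (auto simp: adjoint_hyperplanes_def)
    have "S \<in> vanishing B" "S \<notin> vanishing A" using H S A by (auto simp: vanishing_def)
    then show "m \<notin> H" using g S by (auto dest: generic_vanishing)
  next
    assume m: "m \<in> A \<and> (\<forall>H. H \<in> adjoint_hyperplanes \<and> B \<subseteq> H \<and> \<not> A \<subseteq> H \<longrightarrow> m \<notin> H)"
    show "generic A B m"
    proof (rule genericI, use m in blast, rule ccontr)
      fix S assume S: "S \<in> vanishing B" "sum_on m S = 0" "S \<notin> vanishing A"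
      \<comment> \<open>The two excluded sets have zero sum on \<open>A\<close>, so \<open>S\<close>
        indexes an actual hyperplane.\<close>
      then have "S \<noteq> {}" "S \<noteq> UNIV" using UNIV_vanishing[OF A] by (auto simp: vanishing_def)
      then have "{h \<in> T_vee {UNIV}. sum_on h S = 0} \<in> adjoint_hyperplanes"
        by (auto simp: adjoint_hyperplanes_def)
      moreover have "B \<subseteq> {h \<in> T_vee {UNIV}. sum_on h S = 0}"
        using assms(2) A S(1) by (auto simp: vanishing_def)
      moreover have "\<not> A \<subseteq> {h \<in> T_vee {UNIV}. sum_on h S = 0}"
        using S(3) by (auto simp: vanishing_def)
      ultimately show False using m A S(2) by blast
    qed
  qed
  show ?thesis by (rule set_eqI) (simp add: eq, blast)
qed

text \<open>Prescribing one sign gives the preimage of a point or of an open half-line under a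
  linear functional.\<close>

lemma convex_sign_cell:
  assumes "subspace A"
  shows "convex (sign_cell A B m)"
proof -
  have "convex {h. sgn (sum_on h S) = sgn (sum_on m S)}" for S
  proof -
    consider "sum_on m S = 0" | "sum_on m S > 0" | "sum_on m S < 0" by linarith
    then have "is_interval {r::real. sgn r = sgn (sum_on m S)}"
    proof cases
      case 1
      then have "{r::real. sgn r = sgn (sum_on m S)} = {0}" by (auto simp: sgn_0_0)
      then show ?thesis by (simp add: is_interval_1)
    next
      case 2
      then have "{r::real. sgn r = sgn (sum_on m S)} = {0<..}" by (auto simp: sgn_1_pos)
      then show ?thesis by simp
    next
      case 3
      then have "{r::real. sgn r = sgn (sum_on m S)} = {..<0}" by (auto simp: sgn_1_neg)
      then show ?thesis by simp
    qed
    then have "convex ((\<lambda>h. sum_on h S) -` {r::real. sgn r = sgn (sum_on m S)})"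
      by (intro convex_linear_vimage linear_sum_on) (simp add: is_interval_convex)
    then show ?thesis by (simp add: vimage_def)
  qed
  then have "convex (A \<inter> (\<Inter>S\<in>vanishing B. {h. sgn (sum_on h S) = sgn (sum_on m S)}))"
    by (intro convex_Int convex_INT subspace_imp_convex[OF assms])
  also have "A \<inter> (\<Inter>S\<in>vanishing B. {h. sgn (sum_on h S) = sgn (sum_on m S)}) = sign_cell A B m"
    by (auto simp: sign_cell_def)
  finally show ?thesis .
qed

lemma sign_cell_generic:
  assumes "generic A B m" "h \<in> sign_cell A B m"
  shows "generic A B h"
proof (rule genericI)
  show "h \<in> A" using assms(2) by (simp add: sign_cell_def)
  fix S assume S: "S \<in> vanishing B" "sum_on h S = 0"
  then have "sum_on m S = 0" using assms(2) by (auto simp: sign_cell_def sgn_0_0)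
  with assms(1) S(1) show "S \<in> vanishing A" by (rule generic_vanishing)
qed

text \<open>Cells are convex, hence connected. Conversely, a functional that vanishes on
  \<open>B\<close> but not on all of \<open>A\<close> has no zero at a generic point, so its sign is
  constant along a connected set.\<close>

lemma connected_component_generic:
  assumes "subspace A" "generic A B m"
  shows "connected_component_set {m. generic A B m} m = sign_cell A B m"
proof
  show "sign_cell A B m \<subseteq> connected_component_set {m. generic A B m} m"
    using assms by (intro connected_component_maximal convex_connected convex_sign_cell)
      (auto intro: generic_mem_sign_cell sign_cell_generic)
  show "connected_component_set {m. generic A B m} m \<subseteq> sign_cell A B m"
  proof
    fix h assume "h \<in> connected_component_set {m. generic A B m} m"
    then obtain K where K: "connected K" "K \<subseteq> {m. generic A B m}" "m \<in> K" "h \<in> K"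
      by (auto simp: connected_component_def)
    have "sgn (sum_on h S) = sgn (sum_on m S)" if S: "S \<in> vanishing B" for S
    proof (cases "S \<in> vanishing A")
      case True
      moreover have "h \<in> A" "m \<in> A" using K by (auto simp: generic_def)
      ultimately show ?thesis by (simp add: vanishingD)
    next
      case False
      then have nz: "0 \<notin> (\<lambda>h. sum_on h S) ` K"
        using K S by (force dest: generic_vanishing)
      have "connected ((\<lambda>h. sum_on h S) ` K)"
        by (intro connected_continuous_image K continuous_on_sum_on)
      then have iv: "is_interval ((\<lambda>h. sum_on h S) ` K)"
        by (simp add: is_interval_connected_1)
      have mem: "sum_on h S \<in> (\<lambda>h. sum_on h S) ` K" "sum_on m S \<in> (\<lambda>h. sum_on h S) ` K"
        using K by auto
      have "\<not> (sum_on h S \<le> 0 \<and> 0 \<le> sum_on m S)" "\<not> (sum_on m S \<le> 0 \<and> 0 \<le> sum_on h S)"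
        using iv nz mem unfolding is_interval_1 by blast+
      then show ?thesis by (auto simp: sgn_if)
    qed
    then show "h \<in> sign_cell A B m" using K by (auto simp: sign_cell_def generic_def)
  qed
qed

lemma closed_sign_cone: "subspace A \<Longrightarrow> closed (sign_cone A B m)"
proof -
  assume "subspace A"
  have "closed {h. 0 \<le> sgn (sum_on m S) * sum_on h S}" for S
    by (intro closed_Collect_le continuous_intros continuous_on_sum_on)
  then have "closed (A \<inter> (\<Inter>S\<in>vanishing B. {h. 0 \<le> sgn (sum_on m S) * sum_on h S}))"
    using \<open>subspace A\<close> by (intro closed_Int closed_INT closed_subspace) auto
  also have "A \<inter> (\<Inter>S\<in>vanishing B. {h. 0 \<le> sgn (sum_on m S) * sum_on h S}) = sign_cone A B m"
    by (auto simp: sign_cone_def)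
  finally show ?thesis .
qed

text \<open>Adding a small positive multiple of \<open>m\<close> to a point of the closed cone makes
  every inequality with a nonzero sign strict, so the cone consists of limits of points of the
  cell.\<close>

lemma closure_sign_cell:
  assumes "subspace A" "generic A B m"
  shows "closure (sign_cell A B m) = sign_cone A B m"
proof
  have "sign_cell A B m \<subseteq> sign_cone A B m"
    by (auto simp: sign_cell_def sign_cone_def) (metis abs_ge_zero abs_sgn mult.commute)
  then show "closure (sign_cell A B m) \<subseteq> sign_cone A B m"
    using closed_sign_cone[OF assms(1)] by (rule closure_minimal)
  show "sign_cone A B m \<subseteq> closure (sign_cell A B m)"
  proof
    fix h assume h: "h \<in> sign_cone A B m"
    have "h + inverse (real (Suc k)) *\<^sub>R m \<in> sign_cell A B m" for k
    proof -
      have "h + inverse (real (Suc k)) *\<^sub>R m \<in> A"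
        using h assms by (auto simp: sign_cone_def generic_def intro: subspace_add_scaleR)
      moreover have "sgn (sum_on (h + inverse (real (Suc k)) *\<^sub>R m) S) = sgn (sum_on m S)"
        if S: "S \<in> vanishing B" for S
      proof -
        define c where "c = inverse (real (Suc k))"
        have c: "c > 0" by (simp add: c_def)
        consider "sum_on m S = 0" | "sum_on m S > 0" | "sum_on m S < 0" by linarith
        then have "sgn (sum_on h S + c * sum_on m S) = sgn (sum_on m S)"
        proof cases
          case 1
          \<comment> \<open>Genericity excludes a zero sum at \<open>m\<close> together with a
            nonzero sum at \<open>h\<close>.\<close>
          then have "S \<in> vanishing A" using assms(2) S by (blast dest: generic_vanishing)
          then show ?thesis using h 1 by (auto simp: sign_cone_def vanishing_def)
        next
          case 2
          then have "0 \<le> sum_on h S" "c * sum_on m S > 0"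
            using h S c by (auto simp: sign_cone_def)
          then show ?thesis using 2 by simp
        next
          case 3
          then have "sum_on h S \<le> 0" "c * sum_on m S < 0"
            using h S c by (force simp: sign_cone_def mult_pos_neg)+
          then show ?thesis using 3 by simp
        qed
        then show ?thesis by (simp add: c_def sum_on_add sum_on_scaleR)
      qed
      ultimately show ?thesis by (simp add: sign_cell_def)
    qed
    moreover have "(\<lambda>k. h + inverse (real (Suc k)) *\<^sub>R m) \<longlonglongrightarrow> h + 0 *\<^sub>R m"
      by (intro tendsto_intros LIMSEQ_inverse_real_of_nat)
    ultimately show "h \<in> closure (sign_cell A B m)"
      unfolding closure_sequential by (intro exI[of _ "\<lambda>k. h + inverse (real (Suc k)) *\<^sub>R m"]) simp
  qed
qed

lemma lunes_eq:
  assumes "A \<in> adjoint_flats" "B \<in> adjoint_flats" "B \<subseteq> A"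
  shows "lunes A B = {sign_cone A B m | m. generic A B m}"
proof -
  have A: "subspace A" using assms(1) by (rule flat_subspace)
  have "lunes A B = closure ` components {m. generic A B m}"
    using assms by (auto simp: lunes_def arrangement_complement_eq[OF assms(1,3)])
  also have "\<dots> = {sign_cone A B m | m. generic A B m}"
    using connected_component_generic[OF A] closure_sign_cell[OF A]
    by (fastforce simp: components_def image_iff)
  finally show ?thesis .
qed

section \<open>Composition of lunes\<close>

text \<open>The two inclusions that define a composite fix its signs on complementary sets of
  functionals: \<open>N \<subseteq> M\<close> on those that vanish on \<open>B\<close>,
  \<open>L \<subseteq> N\<close> on the others. So the description has at most one solution, and a
  single generic point supplies one.\<close>

lemma lune_comp_eq:
  assumes flats: "A \<in> adjoint_flats" "B \<in> adjoint_flats" "C \<in> adjoint_flats"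
    and sub: "B \<subseteq> A" "C \<subseteq> B"
    and m: "generic A B m" and l: "generic B C l"
  obtains n where "generic A C n"
    "lune_comp A C (sign_cone B C l) (sign_cone A B m) = sign_cone A C n"
    "\<And>S. S \<in> vanishing B \<Longrightarrow> sgn (sum_on n S) = sgn (sum_on m S)"
    "\<And>S. S \<in> vanishing C \<Longrightarrow> S \<notin> vanishing B \<Longrightarrow> sgn (sum_on n S) = sgn (sum_on l S)"
proof -
  have mA: "m \<in> A" and lB: "l \<in> B" using m l by (simp_all add: generic_def)
  have vBC: "vanishing B \<subseteq> vanishing C" using sub by (intro vanishing_antimono)
  obtain e where e: "0 < e"
    "\<And>S. sum_on l S \<noteq> 0 \<Longrightarrow> sgn (sum_on (l + e *\<^sub>R m) S) = sgn (sum_on l S)"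
    by (rule sgn_add_small_multiple[of l m]) blast
  \<comment> \<open>A small step from \<open>L\<close> into \<open>M\<close>: where \<open>l\<close> vanishes, the sign is that of \<open>m\<close>.\<close>
  define n where "n = l + e *\<^sub>R m"
  have nB: "sgn (sum_on n S) = sgn (sum_on m S)" if "S \<in> vanishing B" for S
    using vanishingD[OF that lB] e(1) by (simp add: n_def sum_on_add sum_on_scaleR sgn_mult)
  have lnz: "sum_on l S \<noteq> 0" if "S \<in> vanishing C" "S \<notin> vanishing B" for S
    using that l by (auto dest: generic_vanishing)
  have nC: "sgn (sum_on n S) = sgn (sum_on l S)" if "S \<in> vanishing C" "S \<notin> vanishing B" for S
    using lnz[OF that] e(2) by (simp add: n_def)
  have nA: "n \<in> A" using mA lB sub flat_subspace[OF flats(1)]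
    by (auto simp: n_def intro: subspace_add_scaleR)
  have gn: "generic A C n"
  proof (rule genericI[OF nA])
    fix S assume S: "S \<in> vanishing C" "sum_on n S = 0"
    show "S \<in> vanishing A"
    proof (cases "S \<in> vanishing B")
      case True
      then have "sum_on m S = 0" using nB S by (metis sgn_0_0)
      then show ?thesis using m True by (rule generic_vanishing[rotated 2])
    next
      case False
      then show ?thesis using nC[OF S(1) False] lnz[OF S(1) False] S(2) by (simp add: sgn_0_0)
    qed
  qed
  have lunes_AC: "lunes A C = {sign_cone A C n | n. generic A C n}"
    using flats sub by (intro lunes_eq) auto
  have unique: "N = sign_cone A C n"
    if N: "N \<in> lunes A C" "sign_cone B C l \<subseteq> N" "N \<subseteq> sign_cone A B m" for N
  proof -
    obtain n' where n': "generic A C n'" "N = sign_cone A C n'" using N(1) lunes_AC by auto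
    \<comment> \<open>Each inclusion is used at one point only: the generic point \<open>n'\<close>
      of \<open>N\<close> lies in \<open>M\<close>, and the generic point \<open>l\<close> of
      \<open>L\<close> lies in \<open>N\<close>.\<close>
    have n'M: "n' \<in> sign_cone A B m" using generic_mem_sign_cone[OF n'(1)] n'(2) N(3) by auto
    have lN: "l \<in> sign_cone A C n'" using generic_mem_sign_cone[OF l] n'(2) N(2) by auto
    have n'A: "S \<in> vanishing A" if "S \<in> vanishing C" "sum_on n' S = 0" for S
      using n'(1) that by (rule generic_vanishing)
    have "sgn (sum_on n' S) = sgn (sum_on n S)" if S: "S \<in> vanishing C" for S
    proof (cases "S \<in> vanishing B")
      case True
      have ge: "0 \<le> sgn (sum_on m S) * sum_on n' S" using n'M True by (auto simp: sign_cone_def)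
      have "sgn (sum_on n' S) = sgn (sum_on m S)"
      proof (cases "S \<in> vanishing A")
        case True
        then show ?thesis using mA n'(1) by (simp add: generic_def vanishing_def)
      next
        case False
        \<comment> \<open>The inequality \<open>ge\<close> is weak; it decides the sign because
          neither sum is zero.\<close>
        then have "sum_on n' S \<noteq> 0" "sum_on m S \<noteq> 0"
          using n'A[OF S] generic_vanishing[OF m True] by blast+
        then show ?thesis using ge by (auto simp: sgn_if split: if_splits)
      qed
      then show ?thesis using nB[OF True] by simp
    next
      case False
      then have "S \<notin> vanishing A" using vanishing_antimono[OF sub(1)] by blast
      then have "sum_on n' S \<noteq> 0" using n'A[OF S] by blast
      moreover have "0 \<le> sgn (sum_on n' S) * sum_on l S" using lN S by (auto simp: sign_cone_def)
      ultimately show ?thesis using nC[OF S False] lnz[OF S False]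
        by (auto simp: sgn_if split: if_splits)
    qed
    then show ?thesis unfolding n'(2) by (rule sign_cone_cong)
  qed
  have "lune_comp A C (sign_cone B C l) (sign_cone A B m) = sign_cone A C n"
    unfolding lune_comp_def
  proof (rule the_equality)
    have "sign_cone B C l \<subseteq> sign_cone A C n"
    proof
      fix h assume h: "h \<in> sign_cone B C l"
      have "0 \<le> sgn (sum_on n S) * sum_on h S" if S: "S \<in> vanishing C" for S
      proof (cases "S \<in> vanishing B")
        case True
        then show ?thesis using h by (simp add: sign_cone_def vanishing_def)
      next
        case False
        then show ?thesis using h S nC[OF S False] by (simp add: sign_cone_def)
      qed
      then show "h \<in> sign_cone A C n" using h sub by (auto simp: sign_cone_def)
    qed
    moreover have "sign_cone A C n \<subseteq> sign_cone A B m"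
      using vBC by (auto simp: sign_cone_def nB[symmetric] subset_iff)
    ultimately show "sign_cone A C n \<in> lunes A C \<and> sign_cone B C l \<subseteq> sign_cone A C n \<and>
        sign_cone A C n \<subseteq> sign_cone A B m"
      using gn lunes_AC by blast
  qed (use unique in blast)
  from gn this nB nC show ?thesis by (rule that)
qed

lemma lune_comp_mem_lunes:
  assumes "A \<in> adjoint_flats" "B \<in> adjoint_flats" "C \<in> adjoint_flats" "B \<subseteq> A" "C \<subseteq> B"
    and "M \<in> lunes A B" "L \<in> lunes B C"
  shows "lune_comp A C L M \<in> lunes A C"
proof -
  obtain m where m: "generic A B m" "M = sign_cone A B m"
    using assms(6) lunes_eq[OF assms(1,2,4)] by blast
  obtain l where l: "generic B C l" "L = sign_cone B C l"
    using assms(7) lunes_eq[OF assms(2,3,5)] by blast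
  obtain n where "generic A C n" "lune_comp A C L M = sign_cone A C n"
    using lune_comp_eq[OF assms(1-5) m(1) l(1)] m(2) l(2) by metis
  moreover have "C \<subseteq> A" using assms(4,5) by simp
  ultimately show ?thesis using lunes_eq[OF assms(1,3)] by auto
qed

lemma lune_comp_assoc:
  assumes flats: "A \<in> adjoint_flats" "B \<in> adjoint_flats" "C \<in> adjoint_flats" "D \<in> adjoint_flats"
    and sub: "B \<subseteq> A" "C \<subseteq> B" "D \<subseteq> C"
    and lunes: "M \<in> lunes A B" "L \<in> lunes B C" "K \<in> lunes C D"
  shows "lune_comp A D (lune_comp B D K L) M = lune_comp A D K (lune_comp A C L M)"
proof -
  obtain m where m: "generic A B m" "M = sign_cone A B m"
    using lunes(1) lunes_eq[OF flats(1,2) sub(1)] by blast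
  obtain l where l: "generic B C l" "L = sign_cone B C l"
    using lunes(2) lunes_eq[OF flats(2,3) sub(2)] by blast
  obtain k where k: "generic C D k" "K = sign_cone C D k"
    using lunes(3) lunes_eq[OF flats(3,4) sub(3)] by blast
  have DB: "D \<subseteq> B" and CA: "C \<subseteq> A" using sub by auto
  obtain p where p: "generic B D p" "lune_comp B D K L = sign_cone B D p"
    "\<And>S. S \<in> vanishing C \<Longrightarrow> sgn (sum_on p S) = sgn (sum_on l S)"
    "\<And>S. S \<in> vanishing D \<Longrightarrow> S \<notin> vanishing C \<Longrightarrow> sgn (sum_on p S) = sgn (sum_on k S)"
    using lune_comp_eq[OF flats(2,3,4) sub(2,3) l(1) k(1)] k(2) l(2) by metis
  obtain q where q: "generic A D q" "lune_comp A D (sign_cone B D p) M = sign_cone A D q"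
    "\<And>S. S \<in> vanishing B \<Longrightarrow> sgn (sum_on q S) = sgn (sum_on m S)"
    "\<And>S. S \<in> vanishing D \<Longrightarrow> S \<notin> vanishing B \<Longrightarrow> sgn (sum_on q S) = sgn (sum_on p S)"
    using lune_comp_eq[OF flats(1,2,4) sub(1) DB m(1) p(1)] m(2) by metis
  obtain r where r: "generic A C r" "lune_comp A C L M = sign_cone A C r"
    "\<And>S. S \<in> vanishing B \<Longrightarrow> sgn (sum_on r S) = sgn (sum_on m S)"
    "\<And>S. S \<in> vanishing C \<Longrightarrow> S \<notin> vanishing B \<Longrightarrow> sgn (sum_on r S) = sgn (sum_on l S)"
    using lune_comp_eq[OF flats(1,2,3) sub(1,2) m(1) l(1)] l(2) m(2) by metis
  obtain s where s: "generic A D s" "lune_comp A D K (sign_cone A C r) = sign_cone A D s"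
    "\<And>S. S \<in> vanishing C \<Longrightarrow> sgn (sum_on s S) = sgn (sum_on r S)"
    "\<And>S. S \<in> vanishing D \<Longrightarrow> S \<notin> vanishing C \<Longrightarrow> sgn (sum_on s S) = sgn (sum_on k S)"
    using lune_comp_eq[OF flats(1,3,4) CA sub(3) r(1) k(1)] k(2) by metis
  \<comment> \<open>This inclusion leaves three ranges for \<open>S\<close>; on them both sides
    carry the signs of \<open>m\<close>, \<open>l\<close> and \<open>k\<close> respectively.\<close>
  have "vanishing B \<subseteq> vanishing C" using sub by (intro vanishing_antimono)
  then have "sgn (sum_on q S) = sgn (sum_on s S)" if "S \<in> vanishing D" for S
    using that p(3,4) q(3,4) r(3,4) s(3,4) by (metis subsetD)
  then have "sign_cone A D q = sign_cone A D s" by (rule sign_cone_cong)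
  then show ?thesis using p(2) q(2) r(2) s(2) by simp
qed

lemma flat_mem_lunes:
  assumes "A \<in> adjoint_flats"
  shows "A \<in> lunes A A"
proof -
  \<comment> \<open>When base and case agree no hyperplane is left, so every point of
    \<open>A\<close> represents the same lune, and zero is always at hand.\<close>
  have "generic A A 0"
    using flat_subspace[OF assms] by (simp add: generic_def subspace_0)
  moreover have "sign_cone A A 0 = A"
    by (simp add: sign_cone_def)
  ultimately show ?thesis
    unfolding lunes_eq[OF assms assms subset_refl] by (metis (mono_tags, lifting) mem_Collect_eq)
qed

lemma lune_comp_flat_right:
  assumes "A \<in> adjoint_flats" "C \<in> adjoint_flats" "C \<subseteq> A" "L \<in> lunes A C"
  shows "lune_comp A C L A = L"
proof -
  obtain l where l: "generic A C l" "L = sign_cone A C l"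
    using assms(4) lunes_eq[OF assms(1-3)] by blast
  have 0: "generic A A 0" "sign_cone A A 0 = A"
    using flat_subspace[OF assms(1)] by (simp_all add: generic_def subspace_0 sign_cone_def)
  obtain n where n: "generic A C n" "lune_comp A C (sign_cone A C l) (sign_cone A A 0) = sign_cone A C n"
    "\<And>S. S \<in> vanishing C \<Longrightarrow> S \<notin> vanishing A \<Longrightarrow> sgn (sum_on n S) = sgn (sum_on l S)"
    using lune_comp_eq[OF assms(1,1,2) subset_refl assms(3) 0(1) l(1)] by metis
  have "sgn (sum_on n S) = sgn (sum_on l S)" if "S \<in> vanishing C" for S
    using n(3)[OF that] vanishingD[OF _ generic_mem[OF n(1)]] vanishingD[OF _ generic_mem[OF l(1)]]
    by (cases "S \<in> vanishing A") auto
  then have "sign_cone A C n = sign_cone A C l" by (rule sign_cone_cong)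
  then show ?thesis using n(2) l(2) 0(2) by simp
qed

section \<open>Faces\<close>

lemma T_vee_singletons: "T_vee singletons = {0 :: real^'i::finite}"
  by (auto simp: T_vee_def singletons_def sum_on_def vec_eq_iff)

lemma vanishing_zero [simp]: "vanishing {0} = UNIV"
  by (simp add: vanishing_def)

lemma singletons_partition: "partition_on UNIV singletons"
  by (auto simp: partition_on_def singletons_def disjoint_def)

lemma zero_flat: "{0 :: real^'i::finite} \<in> adjoint_flats"
  using T_vee_flat[OF singletons_partition] by (simp add: T_vee_singletons)

lemma zero_subset_T_vee: "{0} \<subseteq> T_vee P"
  by (simp add: T_vee_def)

text \<open>A functional that vanishes at one point of a face vanishes on the face, hence on its
  span; this makes the point generic in \<open>T_vee P\<close>. Conversely, a generic point can be
  moved a little in every direction of \<open>T_vee P\<close> without leaving its cell, so the cell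
  spans \<open>T_vee P\<close>.\<close>

lemma faces_on_eq:
  assumes "partition_on UNIV (P :: 'i::finite set set)"
  shows "faces_on P = {sign_cell (T_vee P) {0} m | m. generic (T_vee P) {0} m}"
proof -
  let ?face = "\<lambda>h::real^'i. {h' \<in> T_vee {UNIV}. \<forall>S. S \<noteq> {} \<and> S \<noteq> UNIV \<longrightarrow> sgn (sum_on h' S) = sgn (sum_on h S)}"
  have amb: "T_vee P \<subseteq> T_vee {UNIV}"
    using T_vee_flat[OF assms] by (rule flat_subset_ambient)
  have face: "?face h = {h' \<in> T_vee {UNIV}. \<forall>S. sgn (sum_on h' S) = sgn (sum_on h S)}"
    if "h \<in> T_vee {UNIV}" for h
    using that by (auto simp: T_vee_def) (metis sum_on_empty)
  have face_cell: "?face h = sign_cell (T_vee P) {0} h" if h: "h \<in> T_vee P" for h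
  proof -
    \<comment> \<open>Membership in \<open>T_vee P\<close> is itself a sign condition: the signs at
      the blocks of \<open>P\<close> are zero.\<close>
    have "h' \<in> T_vee P" if "\<forall>S. sgn (sum_on h' S) = sgn (sum_on h S)" for h'
      using h that by (auto simp: T_vee_def) (metis sgn_0_0)
    then show ?thesis unfolding face[OF subsetD[OF amb h]] using amb by (auto simp: sign_cell_def)
  qed
  show ?thesis
  proof (intro subset_antisym subsetI)
    fix X assume "X \<in> faces_on P"
    then obtain h where h: "h \<in> T_vee {UNIV}" "X = ?face h" and sp: "span X = T_vee P"
      by (auto simp: faces_on_def adjoint_faces_def)
    have hX: "h \<in> X" using h by simp
    then have hP: "h \<in> T_vee P" using sp span_base by blast
    have "generic (T_vee P) {0} h"
    proof (rule genericI[OF hP])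
      fix S assume "sum_on h S = 0"
      then have "X \<subseteq> {x. sum_on x S = 0}" using h(1) unfolding h(2) face[OF h(1)]
        by auto (metis sgn_0_0)
      moreover have "subspace {x::real^'i. sum_on x S = 0}"
        by (auto simp: subspace_def sum_on_add sum_on_scaleR)
      ultimately have "span X \<subseteq> {x. sum_on x S = 0}" by (rule span_minimal)
      then show "S \<in> vanishing (T_vee P)" using sp by (auto simp: vanishing_def)
    qed
    then show "X \<in> {sign_cell (T_vee P) {0} m | m. generic (T_vee P) {0} m}"
      using h(2) face_cell[OF hP] by blast
  next
    fix X assume "X \<in> {sign_cell (T_vee P) {0} m | m. generic (T_vee P) {0} m}"
    then obtain m where m: "X = sign_cell (T_vee P) {0} m" "generic (T_vee P) {0} m" by blast
    have mP: "m \<in> T_vee P" using m(2) by (rule generic_mem)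
    have "X = ?face m" using m(1) face_cell[OF mP] by simp
    then have "X \<in> adjoint_faces" using mP amb by (auto simp: adjoint_faces_def)
    moreover have "span X = T_vee P"
    proof
      have "X \<subseteq> T_vee P" by (auto simp: m(1) sign_cell_def)
      then show "span X \<subseteq> T_vee P" using subspace_T_vee by (rule span_minimal)
      show "T_vee P \<subseteq> span X"
      proof
        fix h assume h: "h \<in> T_vee P"
        obtain e where e: "0 < e"
          "\<And>S. sum_on m S \<noteq> 0 \<Longrightarrow> sgn (sum_on (m + e *\<^sub>R h) S) = sgn (sum_on m S)"
          by (rule sgn_add_small_multiple[of m h]) blast
        have "sgn (sum_on (m + e *\<^sub>R h) S) = sgn (sum_on m S)" for S
        proof (cases "sum_on m S = 0")
          case True
          then have "S \<in> vanishing (T_vee P)" using generic_vanishing[OF m(2)] by simp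
          then have "sum_on h S = 0" using h by (rule vanishingD)
          then show ?thesis by (simp add: sum_on_add sum_on_scaleR)
        qed (rule e(2))
        then have "m + e *\<^sub>R h \<in> X"
          using subspace_add_scaleR[OF subspace_T_vee mP h] by (simp add: m(1) sign_cell_def)
        moreover have "m \<in> X" unfolding m(1) using m(2) by (rule generic_mem_sign_cell)
        \<comment> \<open>The direction \<open>h\<close> is a multiple of the difference of two
          points of the cell.\<close>
        ultimately have "(1 / e) *\<^sub>R ((m + e *\<^sub>R h) - m) \<in> span X"
          by (intro span_scale span_diff span_base)
        then show "h \<in> span X" using e(1) by simp
      qed
    qed
    ultimately show "X \<in> faces_on P" by (simp add: faces_on_def)
  qed
qed

lemma face_sign_sign_cell:
  assumes "generic A {0} m"
  shows "face_sign (sign_cell A {0} m) S = sgn (sum_on m S)"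
  unfolding face_sign_def
proof (rule the_equality)
  show "\<forall>h\<in>sign_cell A {0} m. sgn (sum_on h S) = sgn (sum_on m S)"
    by (simp add: sign_cell_def)
qed (use generic_mem_sign_cell[OF assms] in auto)

lemma lunes_zero_eq:
  assumes "partition_on UNIV (P :: 'i::finite set set)"
  shows "lunes (T_vee P) {0} = {sign_cone (T_vee P) {0} m | m. generic (T_vee P) {0} m}"
  by (intro lunes_eq T_vee_flat assms zero_flat zero_subset_T_vee)

text \<open>A face can be recovered from its closure: a generic point of one face that lies in the
  closed cone of another satisfies weak inequalities between nonzero sums, and so has the same
  signs.\<close>

lemma closure_faces_bij_betw:
  assumes "partition_on UNIV (P :: 'i::finite set set)"
  shows "bij_betw closure (faces_on P) (lunes (T_vee P) (T_vee singletons))"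
  unfolding bij_betw_def T_vee_singletons
proof
  show "inj_on closure (faces_on P)"
  proof (rule inj_onI)
    fix X Y assume XY: "X \<in> faces_on P" "Y \<in> faces_on P" and eq: "closure X = closure Y"
    obtain m n where m: "X = sign_cell (T_vee P) {0} m" "generic (T_vee P) {0} m"
      and n: "Y = sign_cell (T_vee P) {0} n" "generic (T_vee P) {0} n"
      using XY unfolding faces_on_eq[OF assms] by blast
    have "m \<in> sign_cone (T_vee P) {0} n"
      using eq generic_mem_sign_cone[OF m(2)] m n by (simp add: closure_sign_cell subspace_T_vee)
    then have ge: "0 \<le> sgn (sum_on n S) * sum_on m S" for S by (simp add: sign_cone_def)
    have "sgn (sum_on m S) = sgn (sum_on n S)" for S
    proof (cases "S \<in> vanishing (T_vee P)")
      case True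
      then show ?thesis
        using generic_mem[OF m(2)] generic_mem[OF n(2)] by (simp add: vanishingD)
    next
      case False
      then have "sum_on m S \<noteq> 0" "sum_on n S \<noteq> 0"
        using generic_vanishing[OF m(2), of S] generic_vanishing[OF n(2), of S] by auto
      then show ?thesis using ge[of S] by (auto simp: sgn_if split: if_splits)
    qed
    then show "X = Y" unfolding m(1) n(1) by (intro sign_cell_cong)
  qed
  show "closure ` faces_on P = lunes (T_vee P) {0}"
    unfolding lunes_zero_eq[OF assms] faces_on_eq[OF assms]
    using closure_sign_cell[OF subspace_T_vee] by blast
qed

section \<open>Shifting and switching\<close>

lemma leaves_shift_ranks [simp]: "leaves (shift_ranks k t) = leaves t"
  by (induction t) simp_all

lemma nodes_shift_ranks [simp]: "nodes (shift_ranks k t) = map ((+) k) (nodes t)"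
  by (induction t) simp_all

lemma root_block_shift_ranks [simp]: "root_block (shift_ranks k t) = root_block t"
  by (simp add: root_block_def)

lemma root_block_Leaf [simp]: "root_block (Leaf B) = B"
  by (simp add: root_block_def)

lemma root_block_Node [simp]: "root_block (Node n l r) = root_block l \<union> root_block r"
  by (simp add: root_block_def)

lemma precedes_descendants_shift_ranks [simp]:
  "precedes_descendants (shift_ranks k t) = precedes_descendants t"
  by (induction t) (simp_all add: ball_Un)

lemma inj_shift_ranks: "inj (shift_ranks k)"
proof (rule injI)
  fix s t :: "'a layered_tree"
  show "shift_ranks k s = shift_ranks k t \<Longrightarrow> s = t"
  proof (induction s arbitrary: t)
    case (Leaf B)
    then show ?case by (cases t) auto
  next
    case (Node n l r)
    then show ?case by (cases t) auto
  qed
qed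

text \<open>Undoes the renumbering by which grafting makes room for one earlier node.\<close>

lemma shift_ranks_one_surj:
  assumes "0 \<notin> set (nodes t)"
  obtains s where "t = shift_ranks 1 s"
proof -
  have "\<exists>s. t = shift_ranks 1 s"
    using assms
  proof (induction t)
    case (Leaf B)
    then show ?case by (intro exI[of _ "Leaf B"]) simp
  next
    case (Node n l r)
    then obtain l' r' where "l = shift_ranks 1 l'" "r = shift_ranks 1 r'" by auto
    then show ?case using Node.prems by (intro exI[of _ "Node (n - 1) l' r'"]) simp
  qed
  then show ?thesis using that by blast
qed

lemma nodes_Nil_iff: "nodes t = [] \<longleftrightarrow> (\<exists>B. t = Leaf B)"
  by (cases t) auto

lemma leaves_not_Nil [simp]: "leaves t \<noteq> []"
  by (induction t) simp_all

lemma set_leaves_switch [simp]: "set (leaves (switch W t)) = set (leaves t)"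
  by (induction t) auto

lemma root_block_switch [simp]: "root_block (switch W t) = root_block t"
  by (simp add: root_block_def)

lemma switch_shift_ranks_one:
  "switch W (shift_ranks 1 t) = shift_ranks 1 (switch {n. Suc n \<in> W} t)"
  by (induction t) auto

lemma tgt_switch [simp]: "tgt (switch W ` F) = tgt F"
  by (simp add: tgt_def image_image)

lemma src_switch [simp]: "src (switch W ` F) = src F"
  by (simp add: src_def)

section \<open>Layered forests\<close>

text \<open>The multiset turns the counting condition of a layered forest into distinctness of all ranks.\<close>

definition ranks :: "'i forest \<Rightarrow> nat multiset" where
  "ranks F = (\<Sum>t\<in>F. mset (nodes t))"

lemma size_ranks: "size (ranks F) = num_nodes F"
  by (simp add: ranks_def num_nodes_def size_multiset_sum)

lemma set_ranks: "finite F \<Longrightarrow> set_mset (ranks F) = (\<Union>t\<in>F. set (nodes t))"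
  by (simp add: ranks_def set_mset_sum)

text \<open>Pigeonhole: a multiset of size \<open>n\<close> with \<open>n\<close> distinct members
  has no repetition.\<close>

lemma mset_eq_mset_set_lessThan:
  assumes "set_mset M = {..<size M}"
  shows "M = mset_set {..<size M}"
proof -
  have "mset_set (set_mset M) \<subseteq># M" by (rule mset_set_set_mset_msubset)
  then have "mset_set {..<size M} \<subseteq># M" using assms by simp
  then show ?thesis by (metis card_lessThan mset_subset_size size_mset_set subset_mset.le_neq_trans less_irrefl)
qed

text \<open>Trees form an infinite type; finiteness comes from the injection into the finitely many
  possible blocks.\<close>

lemma finite_forest:
  fixes F :: "'i::finite forest"
  assumes "inj_on root_block F"
  shows "finite F"
  using finite_imageD[OF _ assms] by simp

lemma partition_on_block_eq:
  assumes "partition_on A P" "X \<in> P" "Y \<in> P" "i \<in> X" "i \<in> Y"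
  shows "X = Y"
  using assms disjointD[of P X Y] by (auto simp: partition_on_def)

text \<open>Trades the leaf condition on each tree for the single equation \<open>src F = Q\<close>,
  which is easier to follow through grafting. The two agree because blocks of \<open>Q\<close> are
  nonempty and disjoint, so a point of a block determines the leaf containing it.\<close>

lemma layered_forest_iff:
  fixes P Q :: "'i::finite set set"
  shows "layered_forest P F Q \<longleftrightarrow>
    partition_on UNIV P \<and> partition_on UNIV Q \<and> inj_on root_block F \<and> tgt F = P \<and> src F = Q \<and>
    (\<forall>t\<in>F. distinct (leaves t) \<and> precedes_descendants t) \<and>
    set_mset (ranks F) = {..<size (ranks F)}"
  (is "_ \<longleftrightarrow> ?R")
proof
  assume L: "layered_forest P F Q"
  then have inj: "inj_on root_block F" and tgt: "root_block ` F = P"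
    by (auto simp: layered_forest_def bij_betw_def)
  have part: "partition_on UNIV P" "partition_on UNIV Q" using L by (auto simp: layered_forest_def)
  have lv: "\<And>t. t \<in> F \<Longrightarrow> set (leaves t) = {B \<in> Q. B \<subseteq> root_block t}"
    using L by (auto simp: layered_forest_def)
  have "src F = Q"
  proof
    show "src F \<subseteq> Q" using lv by (auto simp: src_def)
    show "Q \<subseteq> src F"
    proof
      fix B assume B: "B \<in> Q"
      then have "B \<noteq> {}" using part(2) by (auto simp: partition_on_def)
      then obtain i where i: "i \<in> B" by blast
      have "\<Union>(root_block ` F) = UNIV" using part(1) tgt by (simp add: partition_on_def)
      then obtain t where t: "t \<in> F" "i \<in> root_block t" by blast
      then obtain B' where B': "B' \<in> set (leaves t)" "i \<in> B'" by (auto simp: root_block_def)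
      then have "B' \<in> Q" using lv[OF t(1)] by simp
      then have "B' = B" using partition_on_block_eq[OF part(2)] B i B'(2) by blast
      then show "B \<in> src F" using t(1) B'(1) by (auto simp: src_def)
    qed
  qed
  then show ?R using L inj tgt finite_forest[OF inj]
    by (auto simp: layered_forest_def tgt_def size_ranks set_ranks)
next
  assume R: ?R
  then have part: "partition_on UNIV Q" and inj: "inj_on root_block F" by auto
  have "set (leaves t) = {B \<in> Q. B \<subseteq> root_block t}" if t: "t \<in> F" for t
  proof
    show "set (leaves t) \<subseteq> {B \<in> Q. B \<subseteq> root_block t}"
      using R t by (auto simp: src_def root_block_def)
    show "{B \<in> Q. B \<subseteq> root_block t} \<subseteq> set (leaves t)"
    proof
      fix B assume B: "B \<in> {B \<in> Q. B \<subseteq> root_block t}"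
      then have "B \<noteq> {}" using part by (auto simp: partition_on_def)
      then obtain i where i: "i \<in> B" by blast
      then obtain B' where B': "B' \<in> set (leaves t)" "i \<in> B'"
        using B by (auto simp: root_block_def)
      then have "B' \<in> Q" using R t by (auto simp: src_def)
      then have "B' = B" using partition_on_block_eq[OF part] B i B'(2) by blast
      then show "B \<in> set (leaves t)" using B'(1) by simp
    qed
  qed
  then show "layered_forest P F Q" using R finite_forest[OF inj]
    by (auto simp: layered_forest_def bij_betw_def tgt_def size_ranks set_ranks)
qed

lemma layered_forest_id:
  fixes Q :: "'i::finite set set"
  assumes "partition_on UNIV Q"
  shows "layered_forest Q (forest_id Q) Q"
proof -
  have "inj_on root_block (forest_id Q)" by (auto simp: inj_on_def forest_id_def)
  moreover have "ranks (forest_id Q) = {#}" by (auto simp: ranks_def forest_id_def intro: sum.neutral)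
  ultimately show ?thesis using assms
    by (auto simp: layered_forest_iff tgt_def src_def forest_id_def image_image)
qed

section \<open>Cuts\<close>

text \<open>The set-theoretic content of a cut \<open>[C, D]\<close>, freed from trees. It is
  symmetric in the two parts, so the opposite cut has the same source and target.\<close>

definition splits :: "'i set set \<Rightarrow> 'i set \<Rightarrow> 'i set \<Rightarrow> 'i set set \<Rightarrow> bool" where
  "splits P C D R \<longleftrightarrow> partition_on UNIV P \<and> C \<noteq> {} \<and> D \<noteq> {} \<and> C \<inter> D = {} \<and> C \<union> D \<in> P \<and>
    R = insert C (insert D (P - {C \<union> D}))"

lemma splits_commute: "splits P C D R \<Longrightarrow> splits P D C R"
  by (auto simp: splits_def Un_commute)

lemma splits_notin:
  assumes "splits P C D R"
  shows "C \<noteq> D" "C \<notin> P" "D \<notin> P" "C \<union> D \<notin> R"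
proof -
  have disj: "X = Y" if "X \<in> P" "Y \<in> P" "X \<inter> Y \<noteq> {}" for X Y
    using assms that unfolding splits_def partition_on_def by (metis disjointD)
  have CD: "C \<noteq> {}" "D \<noteq> {}" "C \<inter> D = {}" "C \<union> D \<in> P" using assms by (auto simp: splits_def)
  show "C \<noteq> D" using CD by auto
  have neq: "C \<union> D \<noteq> C" "C \<union> D \<noteq> D" using CD(1-3) by blast+
  show "C \<notin> P" using disj[OF _ CD(4), of C] CD(1) neq(1) by auto
  show "D \<notin> P" using disj[OF _ CD(4), of D] CD(2) neq(2) by auto
  show "C \<union> D \<notin> R" using assms neq by (simp add: splits_def)
qed

lemma splits_partition:
  assumes "splits P C D R"
  shows "partition_on UNIV R"
proof -
  have P: "\<Union>P = UNIV" "disjoint P" "{} \<notin> P" and CD: "C \<noteq> {}" "D \<noteq> {}" "C \<inter> D = {}" "C \<union> D \<in> P"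
    and R: "R = insert C (insert D (P - {C \<union> D}))"
    using assms by (auto simp: splits_def partition_on_def)
  have "\<Union>R = \<Union>(insert (C \<union> D) (P - {C \<union> D}))" by (auto simp: R)
  then have "\<Union>R = UNIV" using P(1) CD(4) by (simp add: insert_absorb)
  moreover have "X \<inter> (C \<union> D) = {}" if "X \<in> P - {C \<union> D}" for X
    using that P(2) CD(4) by (auto simp: disjoint_def)
  then have "disjoint R" using P(2) CD(3) unfolding R by (auto simp: disjoint_def)
  ultimately show ?thesis using P(3) CD by (auto simp: partition_on_def R)
qed

lemma num_nodes_cut:
  fixes P :: "'i::finite set set"
  shows "num_nodes (cut P C D) = 1"
proof -
  have "num_nodes (cut P C D) =
      1 + (\<Sum>t\<in>Leaf ` (P - {C \<union> D}). length (nodes t))"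
    unfolding num_nodes_def cut_def by (subst sum.insert) auto
  also have "(\<Sum>t\<in>Leaf ` (P - {C \<union> D}). length (nodes t)) = 0" by (intro sum.neutral) auto
  finally show ?thesis by simp
qed

lemma left_part_cut [simp]: "left_part (cut P C D) = C"
  unfolding left_part_def by (rule the_equality) (auto simp: cut_def)

lemma right_part_cut [simp]: "right_part (cut P C D) = D"
  unfolding right_part_def by (rule the_equality) (auto simp: cut_def)

lemma tgt_cut: "splits P C D R \<Longrightarrow> tgt (cut P C D) = P"
  by (auto simp: tgt_def cut_def splits_def image_image)

lemma src_cut: "splits P C D R \<Longrightarrow> src (cut P C D) = R"
  by (auto simp: src_def cut_def splits_def)

lemma cut_bar_cut: "splits P C D R \<Longrightarrow> cut_bar (cut P C D) = cut P D C"
  by (simp add: cut_bar_def tgt_cut)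

text \<open>One node in total means one tree with two leaves among bare leaves. Its rank is 0
  because the ranks fill an initial segment.\<close>

lemma is_cut_iff:
  fixes P :: "'i::finite set set"
  shows "is_cut P V R \<longleftrightarrow> (\<exists>C D. splits P C D R \<and> V = cut P C D)"
proof
  assume cut: "is_cut P V R"
  then have L: "layered_forest P V R" and 1: "(\<Sum>t\<in>V. length (nodes t)) = 1"
    by (auto simp: is_cut_def num_nodes_def)
  have inj: "inj_on root_block V" and tgt: "root_block ` V = P" and src: "src V = R"
    using L by (auto simp: layered_forest_iff tgt_def)
  have fin: "finite V" using inj by (rule finite_forest)
  obtain t where t: "t \<in> V" "length (nodes t) = 1" "\<forall>s\<in>V. t \<noteq> s \<longrightarrow> length (nodes s) = 0"
    using 1 sum_eq_1_iff[OF fin] by metis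
  obtain n l r where "t = Node n l r" using t(2) by (cases t) auto
  then obtain C D where tCD: "t = Node n (Leaf C) (Leaf D)"
    using t(2) by (auto simp: nodes_Nil_iff)
  have "set (nodes t) \<subseteq> (\<Union>t\<in>V. set (nodes t))" using t(1) by blast
  also have "(\<Union>t\<in>V. set (nodes t)) = {..<1}" using L cut by (auto simp: layered_forest_def is_cut_def)
  finally have n: "n = 0" using tCD by simp
  have leaf: "\<exists>B. s = Leaf B" if "s \<in> V - {t}" for s
    using t(3) that by (auto simp: nodes_Nil_iff)
  have "root_block ` (V - {t}) = P - {C \<union> D}"
    using inj_on_image_set_diff[OF inj, of V "{t}"] tgt t(1) tCD by simp
  moreover have "Leaf ` root_block ` (V - {t}) = V - {t}"
    using leaf by (force simp: image_image)
  ultimately have "V - {t} = Leaf ` (P - {C \<union> D})" by simp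
  then have V: "V = cut P C D" using t(1) tCD n by (auto simp: cut_def)
  have R: "R = insert C (insert D (P - {C \<union> D}))"
    using src by (auto simp: src_def V cut_def)
  have part: "partition_on UNIV R" "partition_on UNIV P" and "distinct (leaves t)"
    using L t(1) by (auto simp: layered_forest_iff)
  then have "C \<noteq> D" using tCD by simp
  moreover have "C \<in> R" "D \<in> R" using R by auto
  ultimately have "C \<inter> D = {}" "C \<noteq> {}" "D \<noteq> {}"
    using part(1) by (auto simp: partition_on_def dest: disjointD)
  moreover have "root_block t \<in> P" using tgt t(1) by blast
  ultimately have "splits P C D R" using part(2) tCD R by (simp add: splits_def)
  with V show "\<exists>C D. splits P C D R \<and> V = cut P C D" by blast
next
  assume "\<exists>C D. splits P C D R \<and> V = cut P C D"
  then obtain C D where s: "splits P C D R" and V: "V = cut P C D" by blast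
  have "finite V" by (simp add: V cut_def)
  then have "set_mset (ranks V) = {0}" unfolding set_ranks[OF \<open>finite V\<close>] by (auto simp: V cut_def)
  moreover have "size (ranks V) = 1" by (simp add: size_ranks V num_nodes_cut)
  moreover have "inj_on root_block V" by (auto simp: V cut_def inj_on_def)
  moreover have "\<forall>t\<in>V. distinct (leaves t) \<and> precedes_descendants t"
    using splits_notin(1)[OF s] by (auto simp: V cut_def)
  moreover have "partition_on UNIV P" using s by (simp add: splits_def)
  moreover have "tgt V = P" "src V = R" using tgt_cut[OF s] src_cut[OF s] by (simp_all add: V)
  ultimately have "layered_forest P V R"
    using splits_partition[OF s] by (simp add: layered_forest_iff lessThan_Suc)
  then show "is_cut P V R" by (simp add: is_cut_def V num_nodes_cut)
qed

lemma is_cutE: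
  fixes P :: "'i::finite set set"
  assumes "is_cut P V R"
  obtains C D where "splits P C D R" "V = cut P C D"
  using assms by (auto simp: is_cut_iff)

lemma is_cutI:
  fixes P :: "'i::finite set set"
  shows "splits P C D R \<Longrightarrow> is_cut P (cut P C D) R"
  by (auto simp: is_cut_iff)

lemma is_cut_cut_bar:
  fixes P :: "'i::finite set set"
  shows "is_cut P V R \<Longrightarrow> is_cut P (cut_bar V) R"
  by (auto simp: is_cut_iff cut_bar_cut) (metis splits_commute)

lemma is_cut_partition:
  fixes P :: "'i::finite set set"
  assumes "is_cut P V R"
  shows "partition_on UNIV P" "partition_on UNIV R"
  using assms by (auto simp: is_cut_def layered_forest_def)

section \<open>Factorization into cuts\<close>

text \<open>The composite of a cut with the forest made of \<open>a\<close>, \<open>b\<close> and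
  \<open>G\<close>, where \<open>a\<close> and \<open>b\<close> lie over the two parts. Ranks move
  up by one because the cut has a single node.\<close>

definition graft_root :: "'i layered_tree \<Rightarrow> 'i layered_tree \<Rightarrow> 'i forest \<Rightarrow> 'i forest" where
  "graft_root a b G = insert (Node 0 (shift_ranks 1 a) (shift_ranks 1 b)) (shift_ranks 1 ` G)"

lemma root_notin_shift: "Node 0 l r \<notin> shift_ranks 1 ` G"
proof
  assume "Node 0 l r \<in> shift_ranks 1 ` G"
  then obtain t where "Node 0 l r = shift_ranks 1 t" by blast
  then show False by (cases t) auto
qed

text \<open>The new tree is the only member whose root has rank 0, since shifted trees have positive
  ranks; shifting itself is injective.\<close>

lemma graft_root_inject:
  "graft_root a b G = graft_root a' b' G' \<longleftrightarrow> a = a' \<and> b = b' \<and> G = G'"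
proof
  assume eq: "graft_root a b G = graft_root a' b' G'"
  then have "Node 0 (shift_ranks 1 a) (shift_ranks 1 b) \<in> graft_root a' b' G'"
    by (auto simp: graft_root_def)
  then have ab: "a = a'" "b = b'"
    using root_notin_shift[of _ _ G'] by (auto simp: graft_root_def inj_eq[OF inj_shift_ranks])
  have "shift_ranks 1 ` G = shift_ranks 1 ` G'"
    using eq ab root_notin_shift unfolding graft_root_def by (metis insert_ident)
  then have "G = G'" by (simp add: inj_image_eq_iff[OF inj_shift_ranks])
  with ab show "a = a' \<and> b = b' \<and> G = G'" by simp
qed simp

text \<open>Forests are sets, so a coincidence among \<open>a\<close>, \<open>b\<close> and the
  members of \<open>G\<close> would lose ranks on the right-hand side; the hypotheses exclude
  this.\<close>

lemma ranks_graft_root: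
  assumes "finite G" "a \<noteq> b" "a \<notin> G" "b \<notin> G"
  shows "ranks (graft_root a b G) = add_mset 0 (image_mset Suc (ranks (insert a (insert b G))))"
proof -
  have Suc_eq: "(+) (Suc 0) = Suc" by (simp add: fun_eq_iff)
  have "ranks (graft_root a b G) =
      mset (nodes (Node 0 (shift_ranks 1 a) (shift_ranks 1 b))) + (\<Sum>t\<in>shift_ranks 1 ` G. mset (nodes t))"
    unfolding ranks_def graft_root_def using assms(1) root_notin_shift by (subst sum.insert) auto
  also have "(\<Sum>t\<in>shift_ranks 1 ` G. mset (nodes t)) = (\<Sum>t\<in>G. image_mset Suc (mset (nodes t)))"
    by (subst sum.reindex) (auto intro: inj_on_subset[OF inj_shift_ranks] simp: Suc_eq)
  also have "\<dots> = image_mset Suc (ranks G)"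
    unfolding ranks_def using assms(1) by (induction G) auto
  finally show ?thesis using assms by (simp add: ranks_def Suc_eq)
qed

lemma ranks_graft_root_iff:
  assumes "finite G" "a \<noteq> b" "a \<notin> G" "b \<notin> G"
  shows "set_mset (ranks (graft_root a b G)) = {..<size (ranks (graft_root a b G))} \<longleftrightarrow>
    set_mset (ranks (insert a (insert b G))) = {..<size (ranks (insert a (insert b G)))}"
proof -
  have "insert 0 (Suc ` X) = insert 0 (Suc ` Y) \<longleftrightarrow> X = Y" for X Y
    by (metis inj_image_eq_iff inj_Suc insert_ident image_iff nat.distinct(1))
  then show ?thesis by (simp add: ranks_graft_root[OF assms] lessThan_Suc_eq_insert_0)
qed

lemma layered_forest_graft_root:
  fixes P :: "'i::finite set set"
  assumes s: "splits P (root_block a) (root_block b) R"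
    and L: "layered_forest R (insert a (insert b G)) Q" and ab: "a \<notin> G" "b \<notin> G"
  shows "layered_forest P (graft_root a b G) Q"
proof -
  let ?C = "root_block a" and ?D = "root_block b" and ?G = "insert a (insert b G)"
  have part: "partition_on UNIV P" "partition_on UNIV Q" using s L by (auto simp: splits_def layered_forest_iff)
  have inj: "inj_on root_block ?G" and tgt: "root_block ` ?G = R" and src: "src ?G = Q"
    and tr: "\<forall>t\<in>?G. distinct (leaves t) \<and> precedes_descendants t"
    using L by (auto simp: layered_forest_iff tgt_def)
  have neq: "?C \<noteq> ?D" "?C \<union> ?D \<notin> R" "a \<noteq> b" using splits_notin[OF s] by auto
  have fin: "finite G" using finite_forest[OF inj] by simp
  have rG: "root_block ` G = R - {?C, ?D}"
  proof -
    have "?C \<notin> root_block ` G" "?D \<notin> root_block ` G" using inj ab by (auto simp: inj_on_def)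
    then show ?thesis using tgt by auto
  qed
  also have "\<dots> = P - {?C \<union> ?D}" using s splits_notin(2,3)[OF s] by (auto simp: splits_def)
  finally have rG: "root_block ` G = P - {?C \<union> ?D}" .
  have "tgt (graft_root a b G) = P"
    using rG s by (auto simp: tgt_def graft_root_def image_image splits_def)
  moreover have "src (graft_root a b G) = Q"
    using src by (auto simp: src_def graft_root_def)
  moreover have "inj_on root_block (graft_root a b G)"
  proof -
    have "inj_on root_block (shift_ranks 1 ` G)" using inj by (auto simp: inj_on_def)
    moreover have "?C \<union> ?D \<notin> root_block ` shift_ranks 1 ` G" using rG by (simp add: image_image)
    ultimately show ?thesis unfolding graft_root_def inj_on_insert by (simp, blast)
  qed
  \<comment> \<open>A common leaf would be a nonempty subset of the empty set
    \<open>?C \<inter> ?D\<close>.\<close>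
  moreover have "set (leaves a) \<inter> set (leaves b) = {}"
  proof -
    have "?C \<inter> ?D = {}" using s by (simp add: splits_def)
    moreover have "{} \<notin> Q" using part(2) by (simp add: partition_on_def)
    moreover have "X \<in> Q" if "X \<in> set (leaves a)" for X using src that by (auto simp: src_def)
    moreover have "X \<subseteq> ?C \<inter> ?D" if "X \<in> set (leaves a)" "X \<in> set (leaves b)" for X
      using that by (auto simp: root_block_def)
    ultimately show ?thesis by fastforce
  qed
  moreover have "set_mset (ranks (graft_root a b G)) = {..<size (ranks (graft_root a b G))}"
    using L by (subst ranks_graft_root_iff[OF fin neq(3) ab]) (simp add: layered_forest_iff)
  ultimately show ?thesis using part tr by (auto simp: layered_forest_iff graft_root_def)
qed

text \<open>Nodes precede their descendants, so the node of rank 0 has no ancestor and is a root. As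
  rank 0 occurs only once, all remaining ranks are positive and can be lowered by one.\<close>

lemma layered_forest_remove_root:
  fixes P :: "'i::finite set set"
  assumes L: "layered_forest P F Q" and nz: "num_nodes F \<noteq> 0"
  obtains a b G R where "F = graft_root a b G" "splits P (root_block a) (root_block b) R"
    "layered_forest R (insert a (insert b G)) Q" "a \<notin> G" "b \<notin> G"
proof -
  have part: "partition_on UNIV P" "partition_on UNIV Q" and inj: "inj_on root_block F"
    and tgt: "root_block ` F = P" and src: "src F = Q"
    and tr: "\<forall>t\<in>F. distinct (leaves t) \<and> precedes_descendants t"
    and rk: "set_mset (ranks F) = {..<size (ranks F)}"
    using L by (auto simp: layered_forest_iff tgt_def)
  have fin: "finite F" using inj by (rule finite_forest)
  have "0 \<in> set_mset (ranks F)" using rk nz by (simp add: size_ranks)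
  then obtain t where t: "t \<in> F" "0 \<in> set (nodes t)" unfolding set_ranks[OF fin] by blast
  obtain l r where tlr: "t = Node 0 l r" and lr0: "0 \<notin> set (nodes l)" "0 \<notin> set (nodes r)"
  proof (cases t)
    case (Leaf B)
    then show ?thesis using t(2) by simp
  next
    case (Node n l r)
    then have "\<forall>m \<in> set (nodes l) \<union> set (nodes r). n < m" using tr t(1) by auto
    then have "n = 0" "0 \<notin> set (nodes l)" "0 \<notin> set (nodes r)" using t(2) Node by auto
    then show ?thesis using that Node by blast
  qed
  obtain a where a: "l = shift_ranks 1 a" using lr0(1) by (rule shift_ranks_one_surj)
  obtain b where b: "r = shift_ranks 1 b" using lr0(2) by (rule shift_ranks_one_surj)
  have "ranks F = mset (nodes t) + ranks (F - {t})"
    unfolding ranks_def using fin t(1) by (simp add: sum.remove)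
  \<comment> \<open>Distinctness of all ranks enters here: it keeps rank 0 out of every other
    tree.\<close>
  moreover have "count (ranks F) 0 = 1"
    using nz by (subst mset_eq_mset_set_lessThan[OF rk]) (simp add: size_ranks)
  ultimately have "0 \<notin># ranks (F - {t})" using tlr by (auto simp: not_in_iff)
  then have rest0: "0 \<notin> set (nodes s)" if "s \<in> F - {t}" for s
    using that fin by (auto simp: set_ranks)
  define G where "G = {s. shift_ranks 1 s \<in> F - {t}}"
  have shG: "shift_ranks 1 ` G = F - {t}"
  proof
    show "F - {t} \<subseteq> shift_ranks 1 ` G"
    proof
      fix s assume s: "s \<in> F - {t}"
      obtain s' where "s = shift_ranks 1 s'" using rest0[OF s] by (rule shift_ranks_one_surj)
      then show "s \<in> shift_ranks 1 ` G" using s by (auto simp: G_def)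
    qed
  qed (auto simp: G_def)
  have F: "F = graft_root a b G" using t(1) tlr a b shG by (auto simp: graft_root_def)
  let ?C = "root_block a" and ?D = "root_block b"
  define R where "R = insert ?C (insert ?D (P - {?C \<union> ?D}))"
  have roott: "root_block t = ?C \<union> ?D" by (simp add: tlr a b)
  have rG: "root_block ` G = P - {?C \<union> ?D}"
  proof -
    have "root_block ` G = root_block ` (F - {t})" unfolding shG[symmetric] by (simp add: image_image)
    also have "\<dots> = P - {?C \<union> ?D}"
      using inj_on_image_set_diff[OF inj, of F "{t}"] tgt t(1) roott by simp
    finally show ?thesis .
  qed
  have "distinct (leaves t)" using tr t(1) by blast
  then have dl: "distinct (leaves a @ leaves b)" by (simp add: tlr a b)
  have lQ: "set (leaves a) \<subseteq> Q" "set (leaves b) \<subseteq> Q"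
    using src t(1) by (auto simp: src_def tlr a b)
  note disj = partition_on_block_eq[OF part(2)]
  have Q0: "{} \<notin> Q" using part(2) by (simp add: partition_on_def)
  have "?C \<noteq> {}" using lQ(1) Q0 by (cases "leaves a") (auto simp: root_block_def)
  moreover have "?D \<noteq> {}" using lQ(2) Q0 by (cases "leaves b") (auto simp: root_block_def)
  moreover have "?C \<inter> ?D = {}"
  proof (rule ccontr)
    assume "?C \<inter> ?D \<noteq> {}"
    then obtain X Y i where "X \<in> set (leaves a)" "Y \<in> set (leaves b)" "i \<in> X" "i \<in> Y"
      by (auto simp: root_block_def)
    then show False using disj[of X Y i] lQ dl by auto
  qed
  moreover have "?C \<union> ?D \<in> P" using roott tgt t(1) by blast
  ultimately have s: "splits P ?C ?D R" using part(1) by (simp add: splits_def R_def)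
  have ab: "a \<notin> G" "b \<notin> G" "a \<noteq> b"
    using splits_notin[OF s] rG by auto
  have injG: "inj_on root_block G"
  proof (rule inj_onI)
    fix x y assume "x \<in> G" "y \<in> G" "root_block x = root_block y"
    then have "shift_ranks 1 x = shift_ranks 1 y"
      using inj by (auto simp: G_def intro: inj_onD[OF inj])
    then show "x = y" by (simp add: inj_eq[OF inj_shift_ranks])
  qed
  have "finite G" using injG by (rule finite_forest)
  have "layered_forest R (insert a (insert b G)) Q"
    unfolding layered_forest_iff
  proof (intro conjI)
    show "partition_on UNIV R" using s by (rule splits_partition)
    show "partition_on UNIV Q" by (rule part)
    show "inj_on root_block (insert a (insert b G))"
      using injG rG splits_notin[OF s] by (auto simp: inj_on_insert)
    show "tgt (insert a (insert b G)) = R" using rG by (simp add: tgt_def R_def)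
    show "src (insert a (insert b G)) = Q" using src by (auto simp: src_def F graft_root_def)
    show "\<forall>t\<in>insert a (insert b G). distinct (leaves t) \<and> precedes_descendants t"
      using tr by (auto simp: F graft_root_def)
    show "set_mset (ranks (insert a (insert b G))) = {..<size (ranks (insert a (insert b G)))}"
      using ranks_graft_root_iff[OF \<open>finite G\<close> ab(3,1,2)] rk by (simp add: F)
  qed
  with F s ab show ?thesis using that by blast
qed

lemma tree_over_eq:
  assumes "inj_on root_block F" "t \<in> F"
  shows "tree_over F (root_block t) = t"
  unfolding tree_over_def using assms by (intro the_equality) (auto dest: inj_onD)

lemma forest_comp_cut:
  fixes P :: "'i::finite set set"
  shows "forest_comp (cut P C D) G =
    graft_root (tree_over G C) (tree_over G D) (tree_over G ` (P - {C \<union> D}))"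
  unfolding forest_comp_def num_nodes_cut by (simp add: cut_def graft_root_def image_image)

text \<open>Singles out the trees of \<open>H\<close> over \<open>C\<close> and \<open>D\<close>, so
  that facts about \<open>graft_root\<close> apply to any composite with a cut.\<close>

lemma forest_comp_cut_graft_root:
  fixes P :: "'i::finite set set"
  assumes s: "splits P C D R" and L: "layered_forest R H Q"
  obtains a b G where "H = insert a (insert b G)" "root_block a = C" "root_block b = D"
    "a \<notin> G" "b \<notin> G" "forest_comp (cut P C D) H = graft_root a b G"
proof -
  have inj: "inj_on root_block H" and tgt: "root_block ` H = R"
    using L by (auto simp: layered_forest_iff tgt_def)
  have over: "tree_over H B \<in> H" "root_block (tree_over H B) = B" if "B \<in> R" for B
    using that tree_over_eq[OF inj] tgt by auto
  have R: "R = insert C (insert D (P - {C \<union> D}))" using s by (simp add: splits_def)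
  have "H = tree_over H ` R"
  proof
    show "H \<subseteq> tree_over H ` R"
      using tree_over_eq[OF inj] tgt by (metis image_eqI subsetI)
  qed (use over in blast)
  then have "H = insert (tree_over H C) (insert (tree_over H D) (tree_over H ` (P - {C \<union> D})))"
    unfolding R by simp
  moreover have "root_block (tree_over H C) = C" "root_block (tree_over H D) = D"
    using over(2) R by auto
  moreover have "tree_over H C \<notin> tree_over H ` (P - {C \<union> D})" "tree_over H D \<notin> tree_over H ` (P - {C \<union> D})"
    using over(2) R splits_notin[OF s] by (metis (no_types, lifting) DiffD1 imageE insertCI)+
  ultimately show ?thesis using forest_comp_cut[of P C D H] by (rule that)
qed

section \<open>Existence and uniqueness of the factorization\<close>

lemma cut_chain_layered_forest:
  fixes P :: "'i::finite set set"
  assumes "cut_chain P Vs Q" "partition_on UNIV Q"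
  shows "layered_forest P (foldr forest_comp Vs (forest_id Q)) Q"
  using assms(1)
proof (induction Vs arbitrary: P)
  case Nil
  then show ?case using layered_forest_id assms(2) by simp
next
  case (Cons V Vs)
  then obtain R where R: "is_cut P V R" "cut_chain R Vs Q" by auto
  obtain C D where s: "splits P C D R" and V: "V = cut P C D" using R(1) by (rule is_cutE)
  have L: "layered_forest R (foldr forest_comp Vs (forest_id Q)) Q" using R(2) by (rule Cons.IH)
  obtain a b G where "foldr forest_comp Vs (forest_id Q) = insert a (insert b G)"
    "root_block a = C" "root_block b = D" "a \<notin> G" "b \<notin> G"
    "forest_comp (cut P C D) (foldr forest_comp Vs (forest_id Q)) = graft_root a b G"
    using s L by (rule forest_comp_cut_graft_root)
  then show ?case using layered_forest_graft_root[of P a b R G Q] s L V by simp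
qed

lemma num_nodes_graft_root:
  assumes "finite G" "a \<noteq> b" "a \<notin> G" "b \<notin> G"
  shows "num_nodes (graft_root a b G) = Suc (num_nodes (insert a (insert b G)))"
  unfolding size_ranks[symmetric] ranks_graft_root[OF assms] by simp

lemma num_nodes_forest_comp_cut:
  fixes P :: "'i::finite set set"
  assumes s: "splits P C D R" and L: "layered_forest R H Q"
  shows "num_nodes (forest_comp (cut P C D) H) = Suc (num_nodes H)"
proof -
  obtain a b G where G: "H = insert a (insert b G)" "root_block a = C" "root_block b = D"
    "a \<notin> G" "b \<notin> G" "forest_comp (cut P C D) H = graft_root a b G"
    using s L by (rule forest_comp_cut_graft_root)
  have "finite H" using L by (auto simp: layered_forest_iff intro: finite_forest)
  moreover have "a \<noteq> b" using splits_notin(1)[OF s] G by auto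
  ultimately show ?thesis using G num_nodes_graft_root by simp
qed

text \<open>The node count recovers the number of cuts, so two factorizations of one forest have the
  same length.\<close>

lemma num_nodes_cut_chain:
  fixes P :: "'i::finite set set"
  assumes "cut_chain P Vs Q" "partition_on UNIV Q"
  shows "num_nodes (foldr forest_comp Vs (forest_id Q)) = length Vs"
  using assms(1)
proof (induction Vs arbitrary: P)
  case Nil
  show ?case by (simp add: num_nodes_def forest_id_def sum.reindex inj_on_def)
next
  case (Cons V Vs)
  then obtain R where R: "is_cut P V R" "cut_chain R Vs Q" by auto
  obtain C D where s: "splits P C D R" and V: "V = cut P C D" using R(1) by (rule is_cutE)
  show ?case using num_nodes_forest_comp_cut[OF s cut_chain_layered_forest[OF R(2) assms(2)]] Cons.IH[OF R(2)] V
    by simp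
qed

lemma cut_chain_exists:
  fixes P :: "'i::finite set set"
  assumes "layered_forest P F Q"
  obtains Vs where "cut_chain P Vs Q" "foldr forest_comp Vs (forest_id Q) = F"
proof -
  have "\<exists>Vs. cut_chain P Vs Q \<and> foldr forest_comp Vs (forest_id Q) = F"
    using assms
  proof (induction "num_nodes F" arbitrary: P F)
    case 0
    have inj: "inj_on root_block F" and tgt: "root_block ` F = P" and src: "src F = Q"
      using 0 by (auto simp: layered_forest_iff tgt_def)
    have leaf: "\<exists>B. t = Leaf B" if "t \<in> F" for t
      using 0(1) that finite_forest[OF inj] by (auto simp: num_nodes_def nodes_Nil_iff)
    have "F = Leaf ` P" unfolding tgt[symmetric] using leaf by (force simp: image_image)
    moreover from this have "P = Q" using src by (auto simp: src_def)
    ultimately show ?case by (intro exI[of _ "[]"]) (simp add: forest_id_def)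
  next
    case (Suc n)
    then have "num_nodes F \<noteq> 0" by simp
    with Suc.prems obtain a b G R where F: "F = graft_root a b G"
      and s: "splits P (root_block a) (root_block b) R"
      and L: "layered_forest R (insert a (insert b G)) Q" and ab: "a \<notin> G" "b \<notin> G"
      by (rule layered_forest_remove_root)
    let ?H = "insert a (insert b G)"
    have inj: "inj_on root_block ?H" using L by (auto simp: layered_forest_iff)
    then have fin: "finite ?H" by (rule finite_forest)
    have neq: "a \<noteq> b" using splits_notin(1)[OF s] by auto
    have "num_nodes ?H = n"
      using Suc.hyps(2) num_nodes_graft_root[of G a b] fin neq ab F by simp
    then obtain Vs where Vs: "cut_chain R Vs Q" "foldr forest_comp Vs (forest_id Q) = ?H"
      using Suc.hyps(1) L by blast
    \<comment> \<open>These trees are chosen anew; since trees of \<open>?H\<close> with equal root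
      blocks coincide, they turn out to be \<open>a\<close>, \<open>b\<close> and \<open>G\<close>
      again.\<close>
    obtain a' b' G' where G': "?H = insert a' (insert b' G')" "root_block a' = root_block a"
      "root_block b' = root_block b" "a' \<notin> G'" "b' \<notin> G'"
      "forest_comp (cut P (root_block a) (root_block b)) ?H = graft_root a' b' G'"
      using s L by (rule forest_comp_cut_graft_root)
    have "a' = a" "b' = b" using inj_onD[OF inj, of a' a] inj_onD[OF inj, of b' b] G'(1,2,3) by auto
    moreover from this have "G' = G" using G'(1,4,5) ab by auto
    ultimately have "forest_comp (cut P (root_block a) (root_block b)) ?H = F" using G'(6) F by simp
    then show ?case using Vs is_cutI[OF s]
      by (intro exI[of _ "cut P (root_block a) (root_block b) # Vs"]) auto
  qed
  then show ?thesis using that by blast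
qed

text \<open>Comparing the two trees whose root has rank 0 identifies the subtrees grafted on the
  first cut. Their root blocks are its parts, which fixes the cut and with it the intermediate
  partition.\<close>

lemma cut_chain_unique:
  fixes P :: "'i::finite set set"
  assumes "cut_chain P Vs Q" "cut_chain P Ws Q" "partition_on UNIV Q"
    and "foldr forest_comp Vs (forest_id Q) = foldr forest_comp Ws (forest_id Q)"
  shows "Vs = Ws"
  using assms(1,2,4)
proof (induction Vs arbitrary: P Ws)
  case Nil
  then have "length Ws = 0"
    using num_nodes_cut_chain[OF _ assms(3)] by (metis list.size(3))
  then show ?case by simp
next
  case (Cons V Vs)
  have "length Ws = length (V # Vs)"
    using num_nodes_cut_chain[OF _ assms(3)] Cons.prems by metis
  then obtain W Ws' where Ws: "Ws = W # Ws'" by (cases Ws) auto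
  obtain R where R: "is_cut P V R" "cut_chain R Vs Q" using Cons.prems by auto
  obtain R' where R': "is_cut P W R'" "cut_chain R' Ws' Q" using Cons.prems Ws by auto
  obtain C D where s: "splits P C D R" and V: "V = cut P C D" using R(1) by (rule is_cutE)
  obtain C' D' where s': "splits P C' D' R'" and W: "W = cut P C' D'" using R'(1) by (rule is_cutE)
  let ?H = "foldr forest_comp Vs (forest_id Q)" and ?H' = "foldr forest_comp Ws' (forest_id Q)"
  obtain a b G where G: "?H = insert a (insert b G)" "root_block a = C" "root_block b = D"
    "a \<notin> G" "b \<notin> G" "forest_comp (cut P C D) ?H = graft_root a b G"
    using s cut_chain_layered_forest[OF R(2) assms(3)] by (rule forest_comp_cut_graft_root)
  obtain a' b' G' where G': "?H' = insert a' (insert b' G')" "root_block a' = C'" "root_block b' = D'"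
    "a' \<notin> G'" "b' \<notin> G'" "forest_comp (cut P C' D') ?H' = graft_root a' b' G'"
    using s' cut_chain_layered_forest[OF R'(2) assms(3)] by (rule forest_comp_cut_graft_root)
  have eq: "a = a'" "b = b'" "G = G'"
    using Cons.prems(3) G(6) G'(6) Ws V W by (simp_all add: graft_root_inject)
  then have "V = W" "R = R'" "?H = ?H'"
    using G G' V W s s' by (simp_all add: splits_def)
  then show ?case using Cons.IH[of R Ws'] R R' Ws by simp
qed

lemma cuts_of_foldr:
  fixes P :: "'i::finite set set"
  assumes "cut_chain P Vs Q" "partition_on UNIV Q"
  shows "cuts_of (foldr forest_comp Vs (forest_id Q)) = Vs"
proof -
  have L: "layered_forest P (foldr forest_comp Vs (forest_id Q)) Q"
    using assms by (rule cut_chain_layered_forest)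
  then have "tgt (foldr forest_comp Vs (forest_id Q)) = P" "src (foldr forest_comp Vs (forest_id Q)) = Q"
    by (auto simp: layered_forest_iff)
  then show ?thesis unfolding cuts_of_def
    using assms cut_chain_unique by (intro the_equality) (auto, blast)
qed

lemma cuts_of_cut_chain:
  fixes P :: "'i::finite set set"
  assumes "layered_forest P F Q"
  shows "cut_chain P (cuts_of F) Q" "foldr forest_comp (cuts_of F) (forest_id Q) = F"
proof -
  obtain Vs where Vs: "cut_chain P Vs Q" "foldr forest_comp Vs (forest_id Q) = F"
    using assms by (rule cut_chain_exists)
  have "partition_on UNIV Q" using assms by (simp add: layered_forest_iff)
  then have "cuts_of F = Vs" using cuts_of_foldr[OF Vs(1)] Vs(2) by simp
  with Vs show "cut_chain P (cuts_of F) Q" "foldr forest_comp (cuts_of F) (forest_id Q) = F"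
    by simp_all
qed

lemma length_cuts_of:
  fixes P :: "'i::finite set set"
  assumes "layered_forest P F Q"
  shows "length (cuts_of F) = num_nodes F"
  using num_nodes_cut_chain[OF cuts_of_cut_chain(1)[OF assms]] cuts_of_cut_chain(2)[OF assms] assms
  by (simp add: layered_forest_iff)

lemma cuts_of_is_cut:
  fixes P :: "'i::finite set set"
  assumes "is_cut P V Q"
  shows "cuts_of V = [V]"
proof -
  obtain C D where s: "splits P C D Q" and V: "V = cut P C D" using assms by (rule is_cutE)
  have part: "partition_on UNIV Q" using s by (rule splits_partition)
  have over: "tree_over (forest_id Q) B = Leaf B" if "B \<in> Q" for B
    using tree_over_eq[of "forest_id Q" "Leaf B"] that by (auto simp: forest_id_def inj_on_def)
  have "C \<in> Q" "D \<in> Q" "P - {C \<union> D} \<subseteq> Q" using s by (auto simp: splits_def)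
  then have "tree_over (forest_id Q) C = Leaf C" "tree_over (forest_id Q) D = Leaf D"
    "tree_over (forest_id Q) ` (P - {C \<union> D}) = Leaf ` (P - {C \<union> D})"
    using over by (auto intro!: image_cong)
  then have "forest_comp V (forest_id Q) = V"
    unfolding V forest_comp_cut by (simp add: graft_root_def cut_def image_image)
  then show ?thesis using cuts_of_foldr[of P "[V]" Q] assms part by simp
qed

section \<open>Switching the cuts of a factorization\<close>

text \<open>The cut at position \<open>k\<close> of a factorization contributes the node of rank
  \<open>k\<close>, so one set \<open>W\<close> selects both nodes of a forest and entries of its
  list of cuts.\<close>

primrec switch_cuts :: "nat set \<Rightarrow> 'i forest list \<Rightarrow> 'i forest list" where
  "switch_cuts W [] = []"
| "switch_cuts W (V # Vs) = (if 0 \<in> W then cut_bar V else V) # switch_cuts {n. Suc n \<in> W} Vs"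

lemma cut_chain_switch_cuts:
  fixes P :: "'i::finite set set"
  shows "cut_chain P Vs Q \<Longrightarrow> cut_chain P (switch_cuts W Vs) Q"
  by (induction Vs arbitrary: P W) (auto intro: is_cut_cut_bar)

lemma tree_over_switch:
  assumes "inj_on root_block F" "B \<in> root_block ` F"
  shows "tree_over (switch W ` F) B = switch W (tree_over F B)"
proof -
  obtain t where t: "t \<in> F" "B = root_block t" using assms(2) by (elim imageE)
  have "inj_on root_block (switch W ` F)"
    by (rule inj_on_imageI) (use assms(1) in \<open>simp add: inj_on_def\<close>)
  then show ?thesis using tree_over_eq[of "switch W ` F" "switch W t"] tree_over_eq[OF assms(1) t(1)] t
    by simp
qed

text \<open>A switch at rank 0 exchanges the two trees grafted on the first cut, which amounts to
  grafting on the opposite cut; all other switches act inside the shifted trees.\<close>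

lemma switch_foldr_forest_comp:
  fixes P :: "'i::finite set set"
  assumes "cut_chain P Vs Q" "partition_on UNIV Q"
  shows "switch W ` foldr forest_comp Vs (forest_id Q) = foldr forest_comp (switch_cuts W Vs) (forest_id Q)"
  using assms(1)
proof (induction Vs arbitrary: P W)
  case Nil
  show ?case by (simp add: forest_id_def image_image)
next
  case (Cons V Vs)
  then obtain R where R: "is_cut P V R" "cut_chain R Vs Q" by auto
  obtain C D where s: "splits P C D R" and V: "V = cut P C D" using R(1) by (rule is_cutE)
  let ?H = "foldr forest_comp Vs (forest_id Q)" and ?W = "{n. Suc n \<in> W}"
  have "layered_forest R ?H Q" using R(2) assms(2) by (rule cut_chain_layered_forest)
  then have "inj_on root_block ?H" "root_block ` ?H = R" by (auto simp: layered_forest_iff tgt_def)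
  then have over: "tree_over (switch ?W ` ?H) B = switch ?W (tree_over ?H B)" if "B \<in> R" for B
    using that tree_over_switch by blast
  have R': "C \<in> R" "D \<in> R" "\<And>B. B \<in> P \<Longrightarrow> B \<noteq> C \<union> D \<Longrightarrow> B \<in> R" using s by (auto simp: splits_def)
  have "switch W ` foldr forest_comp (V # Vs) (forest_id Q) =
      forest_comp (if 0 \<in> W then cut_bar V else V) (switch ?W ` ?H)"
    by (simp add: V cut_bar_cut[OF s] forest_comp_cut graft_root_def image_image
        switch_shift_ranks_one[unfolded One_nat_def] over R' Un_commute[of D C] cong: image_cong_simp)
  then show ?case using Cons.IH[OF R(2)] by simp
qed

lemma cuts_of_switch:
  fixes P :: "'i::finite set set"
  assumes "layered_forest P F Q"
  shows "cuts_of (switch W ` F) = switch_cuts W (cuts_of F)"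
proof -
  have part: "partition_on UNIV Q" using assms by (simp add: layered_forest_iff)
  note c = cuts_of_cut_chain[OF assms]
  have "switch W ` F = foldr forest_comp (switch_cuts W (cuts_of F)) (forest_id Q)"
    using switch_foldr_forest_comp[OF c(1) part] c(2) by simp
  then show ?thesis using cuts_of_foldr[OF cut_chain_switch_cuts[OF c(1)] part] by simp
qed

section \<open>Half-spaces and cut derivatives\<close>

text \<open>Whole blocks contribute zero, so on \<open>T_vee P\<close> a subset sum depends on
  \<open>S\<close> only modulo \<open>P\<close>.\<close>

lemma sum_on_Redn:
  assumes "partition_on UNIV (P :: 'i::finite set set)" "h \<in> T_vee P"
  shows "sum_on h (Redn P S) = sum_on h S"
proof -
  have "disjoint {B \<in> P. B \<subseteq> S}"
    using assms(1) by (auto simp: partition_on_def disjoint_def)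
  then have "sum_on h (\<Union>{B \<in> P. B \<subseteq> S}) = 0"
    using assms(2) by (simp add: sum_on_Union T_vee_def)
  moreover have "\<Union>{B \<in> P. B \<subseteq> S} \<subseteq> S" by blast
  ultimately show ?thesis by (simp add: Redn_def sum_on_diff)
qed

lemma sum_on_axis_diff:
  "sum_on (axis i 1 - axis j 1) S = (if i \<in> S then 1 else 0) - (if j \<in> S then 1 else (0::real))"
  by (simp add: sum_on_def axis_def sum_subtractf if_distrib[of "\<lambda>x. x = _"] sum.delta' cong: if_cong)

text \<open>These differences of unit vectors are the test vectors that show a subset sum to be
  nonzero somewhere on the flat.\<close>

lemma axis_diff_mem_T_vee:
  assumes "partition_on UNIV (P :: 'i::finite set set)" "B \<in> P" "i \<in> B" "j \<in> B"
  shows "axis i 1 - axis j 1 \<in> (T_vee P :: (real^'i) set)"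
proof -
  have "i \<in> S \<longleftrightarrow> j \<in> S" if "S \<in> P" for S
    using partition_on_block_eq[OF assms(1,2) that] assms(3,4) by blast
  then show ?thesis by (auto simp: T_vee_def sum_on_axis_diff)
qed

lemma vanishing_T_vee:
  assumes "partition_on UNIV (P :: 'i::finite set set)"
  shows "S \<in> vanishing (T_vee P :: (real^'i) set) \<longleftrightarrow> Redn P S = {}"
proof
  assume "Redn P S = {}"
  then show "S \<in> vanishing (T_vee P :: (real^'i) set)"
    using sum_on_Redn[OF assms, of _ S] by (auto simp: vanishing_def)
next
  assume v: "S \<in> vanishing (T_vee P :: (real^'i) set)"
  show "Redn P S = {}"
  proof (rule ccontr)
    assume "Redn P S \<noteq> {}"
    then obtain i where i: "i \<in> S" "\<And>B. B \<in> P \<Longrightarrow> B \<subseteq> S \<Longrightarrow> i \<notin> B" by (auto simp: Redn_def)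
    have "i \<in> \<Union>P" using assms by (simp add: partition_on_def)
    then obtain B where B: "B \<in> P" "i \<in> B" by blast
    \<comment> \<open>The block containing \<open>i\<close> is not inside \<open>S\<close>, so it
      has a point outside; the test vector of the two points has sum 1 over
      \<open>S\<close>.\<close>
    then obtain j where j: "j \<in> B" "j \<notin> S" using i(2) by blast
    have "sum_on (axis i 1 - axis j 1 :: real^'i) S = 0"
      using v axis_diff_mem_T_vee[OF assms B j(1)] by (rule vanishingD)
    then show False using i(1) j(2) by (simp add: sum_on_axis_diff)
  qed
qed

lemma Redn_empty [simp]: "Redn P {} = {}"
  by (simp add: Redn_def)

lemma Redn_part:
  assumes "splits P C D R"
  shows "Redn P C = C"
proof -
  have P: "partition_on UNIV P" and CD: "D \<noteq> {}" "C \<inter> D = {}" "C \<union> D \<in> P"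
    using assms by (auto simp: splits_def)
  have "\<not> B \<subseteq> C" if "B \<in> P" for B
  proof
    assume "B \<subseteq> C"
    moreover have "B \<noteq> {}" using P that by (auto simp: partition_on_def)
    ultimately obtain i where "i \<in> B" "i \<in> C \<union> D" by blast
    then have "B = C \<union> D" using partition_on_block_eq[OF P that CD(3)] by blast
    then show False using \<open>B \<subseteq> C\<close> CD(1,2) by blast
  qed
  then show ?thesis by (auto simp: Redn_def)
qed

lemma splits_T_vee_subset:
  assumes "splits P C D (R :: 'i::finite set set)"
  shows "T_vee R \<subseteq> (T_vee P :: (real^'i) set)"
proof
  fix h :: "real^'i" assume h: "h \<in> T_vee R"
  have R: "R = insert C (insert D (P - {C \<union> D}))" and CD: "C \<inter> D = {}"
    using assms by (auto simp: splits_def)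
  have "sum_on h C = 0" "sum_on h D = 0" using h R by (auto simp: T_vee_def)
  then have "sum_on h (C \<union> D) = 0" using CD by (simp add: sum_on_def sum.union_disjoint)
  then show "h \<in> T_vee P" using h R by (auto simp: T_vee_def)
qed

text \<open>\<open>S\<close> is a union of blocks of \<open>R\<close>, and apart from
  \<open>C\<close> and \<open>D\<close> these are blocks of \<open>P\<close>. So only
  \<open>C\<close> or \<open>D\<close> can survive the reduction, and if \<open>S\<close> contains
  both, their union is removed as a block of \<open>P\<close>.\<close>

lemma Redn_splits_empty:
  assumes s: "splits P C D R" and S: "Redn R S = {}"
  shows "Redn P S \<in> {{}, C, D}"
proof -
  have P: "partition_on UNIV P" and CD: "C \<noteq> {}" "D \<noteq> {}" "C \<inter> D = {}" "C \<union> D \<in> P"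
    and R: "R = insert C (insert D (P - {C \<union> D}))"
    using s by (auto simp: splits_def)
  have block: "\<exists>B\<in>R. i \<in> B \<and> B \<subseteq> S" if "i \<in> S" for i using S that by (auto simp: Redn_def)
  have whole: "B = C \<union> D" if "B \<in> P" "i \<in> B" "i \<in> C \<union> D" for B i
    using partition_on_block_eq[OF P that(1) CD(4)] that(2,3) by blast
  have Redn_sub: "Redn P S \<subseteq> (if C \<subseteq> S then C else {}) \<union> (if D \<subseteq> S then D else {})"
  proof
    fix i assume i: "i \<in> Redn P S"
    then have "i \<in> S" and nP: "\<And>B. B \<in> P \<Longrightarrow> B \<subseteq> S \<Longrightarrow> i \<notin> B" by (auto simp: Redn_def)
    then obtain B where "B \<in> R" "i \<in> B" "B \<subseteq> S" using block by blast
    then show "i \<in> (if C \<subseteq> S then C else {}) \<union> (if D \<subseteq> S then D else {})"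
      using nP R by auto
  qed
  \<comment> \<open>Unless \<open>S\<close> contains the whole block \<open>C \<union> D\<close>, no
    block of \<open>P\<close> inside \<open>S\<close> meets that block, so nothing of
    \<open>X\<close> is removed.\<close>
  have inside: "Redn P S = X"
    if X: "X \<subseteq> S" "X \<subseteq> C \<union> D" and Y: "\<not> C \<union> D \<subseteq> S" and sub: "Redn P S \<subseteq> X" for X
  proof
    show "X \<subseteq> Redn P S"
    proof
      fix i assume "i \<in> X"
      then have i: "i \<in> S" "i \<in> C \<union> D" using X by auto
      then have "i \<notin> B" if "B \<in> P" "B \<subseteq> S" for B using whole[OF that(1), of i] that(2) Y by blast
      then show "i \<in> Redn P S" using i(1) by (auto simp: Redn_def)
    qed
  qed (rule sub)
  show ?thesis
  proof (cases "C \<subseteq> S"; cases "D \<subseteq> S")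
    assume CS: "C \<subseteq> S" "D \<subseteq> S"
    then have "Redn P S \<inter> (C \<union> D) = {}" using CD(4) by (auto simp: Redn_def)
    then show ?thesis using Redn_sub CS by auto
  next
    assume CS: "C \<subseteq> S" "\<not> D \<subseteq> S"
    then have "Redn P S = C" using Redn_sub by (intro inside) auto
    then show ?thesis by simp
  next
    assume CS: "\<not> C \<subseteq> S" "D \<subseteq> S"
    then have "Redn P S = D" using Redn_sub by (intro inside) auto
    then show ?thesis by simp
  next
    assume "\<not> C \<subseteq> S" "\<not> D \<subseteq> S"
    then show ?thesis using Redn_sub by auto
  qed
qed

lemma vanishing_T_vee_splits:
  assumes s: "splits P C D (R :: 'i::finite set set)"
  shows "S \<in> vanishing (T_vee R :: (real^'i) set) \<longleftrightarrow> Redn P S \<in> {{}, C, D}"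
proof
  assume "S \<in> vanishing (T_vee R :: (real^'i) set)"
  then show "Redn P S \<in> {{}, C, D}"
    using Redn_splits_empty[OF s] vanishing_T_vee[OF splits_partition[OF s]] by simp
next
  assume S: "Redn P S \<in> {{}, C, D}"
  have P: "partition_on UNIV P" and R: "R = insert C (insert D (P - {C \<union> D}))"
    using s by (auto simp: splits_def)
  show "S \<in> vanishing (T_vee R :: (real^'i) set)"
    unfolding vanishing_def
  proof safe
    fix h :: "real^'i" assume h: "h \<in> T_vee R"
    then have "sum_on h (Redn P S) = 0" using S R by (auto simp: T_vee_def)
    then show "sum_on h S = 0" using sum_on_Redn[OF P] splits_T_vee_subset[OF s] h by (metis subsetD)
  qed
qed

section \<open>The lune of a single cut\<close>

text \<open>Modulo \<open>P\<close> the functionals that vanish on \<open>T_vee R\<close> are the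
  sums over \<open>{}\<close>, \<open>C\<close> and \<open>D\<close>. On \<open>T_vee P\<close> the
  last two are opposite, so the single inequality at \<open>C\<close> defines the whole
  cone.\<close>

lemma half_space_cut:
  assumes s: "splits P C D (R :: 'i::finite set set)"
  obtains m :: "real^'i" where "generic (T_vee P) (T_vee R) m"
    "half_space (cut P C D) = sign_cone (T_vee P) (T_vee R) m"
    "\<And>S. Redn P S = C \<Longrightarrow> sgn (sum_on m S) = 1"
    "\<And>S. Redn P S = D \<Longrightarrow> sgn (sum_on m S) = - 1"
    "\<And>S. Redn P S = {} \<Longrightarrow> sgn (sum_on m S) = 0"
proof -
  have P: "partition_on UNIV P" and CD: "C \<noteq> {}" "D \<noteq> {}" "C \<inter> D = {}" "C \<union> D \<in> P"
    using s by (auto simp: splits_def)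
  obtain i j where ij: "i \<in> C" "j \<in> D" using CD by blast
  \<comment> \<open>Moving one unit from \<open>D\<close> to \<open>C\<close> preserves all block
    sums of \<open>P\<close> and gives sum 1 over \<open>C\<close> and -1 over \<open>D\<close>: a
    point strictly inside the half-space.\<close>
  define m :: "real^'i" where "m = axis i 1 - axis j 1"
  have mP: "m \<in> T_vee P" unfolding m_def using axis_diff_mem_T_vee[OF P CD(4)] ij by blast
  have mS: "sum_on m S = sum_on m (Redn P S)" for S using sum_on_Redn[OF P mP] by simp
  have mCD: "sum_on m C = 1" "sum_on m D = - 1"
    using ij CD(3) by (auto simp: m_def sum_on_axis_diff)
  have gen: "generic (T_vee P) (T_vee R) m"
  proof (rule genericI[OF mP])
    fix S assume "S \<in> vanishing (T_vee R :: (real^'i) set)" and 0: "sum_on m S = 0"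
    then have "Redn P S \<in> {{}, C, D}" using vanishing_T_vee_splits[OF s] by blast
    then have "Redn P S = {}" using 0 mCD by (subst (asm) mS) auto
    then show "S \<in> vanishing (T_vee P)" using vanishing_T_vee[OF P] by blast
  qed
  have "half_space (cut P C D) = {h \<in> T_vee P. 0 \<le> sum_on h C}"
    by (simp add: half_space_def tgt_cut[OF s])
  also have "\<dots> = sign_cone (T_vee P) (T_vee R) m"
  proof (intro subset_antisym subsetI)
    fix h assume "h \<in> {h \<in> T_vee P. 0 \<le> sum_on h C}"
    then have h: "h \<in> T_vee P" "0 \<le> sum_on h C" by auto
    have "sum_on h (C \<union> D) = 0" using h(1) CD(4) by (simp add: T_vee_def)
    then have hD: "sum_on h D \<le> 0" using h(2) CD(3) by (simp add: sum_on_def sum.union_disjoint)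
    have "0 \<le> sgn (sum_on m S) * sum_on h S" if "S \<in> vanishing (T_vee R :: (real^'i) set)" for S
    proof -
      have "Redn P S \<in> {{}, C, D}" using that vanishing_T_vee_splits[OF s] by blast
      then have "0 \<le> sgn (sum_on m (Redn P S)) * sum_on h (Redn P S)"
        using mCD h(2) hD by auto
      then show ?thesis using mS sum_on_Redn[OF P h(1)] by simp
    qed
    then show "h \<in> sign_cone (T_vee P) (T_vee R) m" using h(1) by (simp add: sign_cone_def)
  next
    fix h assume h: "h \<in> sign_cone (T_vee P) (T_vee R) m"
    have "C \<in> vanishing (T_vee R :: (real^'i) set)"
      using vanishing_T_vee_splits[OF s] Redn_part[OF s] by blast
    then show "h \<in> {h \<in> T_vee P. 0 \<le> sum_on h C}" using h mCD(1) by (auto simp: sign_cone_def)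
  qed
  finally have half: "half_space (cut P C D) = sign_cone (T_vee P) (T_vee R) m" .
  have "sgn (sum_on m S) = 1" if "Redn P S = C" for S using mS[of S] mCD that by simp
  moreover have "sgn (sum_on m S) = - 1" if "Redn P S = D" for S using mS[of S] mCD that by simp
  moreover have "sgn (sum_on m S) = 0" if "Redn P S = {}" for S using mS[of S] that by simp
  ultimately show ?thesis by (rule that[OF gen half])
qed

lemma half_space_mem_lunes:
  assumes "is_cut P V (R :: 'i::finite set set)"
  shows "half_space V \<in> lunes (T_vee P :: (real^'i) set) (T_vee R)"
proof -
  obtain C D where s: "splits P C D R" and V: "V = cut P C D" using assms by (rule is_cutE)
  obtain m :: "real^'i" where "generic (T_vee P) (T_vee R) m"
    "half_space V = sign_cone (T_vee P) (T_vee R) m"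
    using half_space_cut[OF s] unfolding V by metis
  then show ?thesis
    using lunes_eq[OF T_vee_flat T_vee_flat splits_T_vee_subset[OF s]] is_cut_partition[OF assms] by blast
qed

lemma closure_face_mem_lunes:
  assumes "partition_on UNIV (P :: 'i::finite set set)" "X \<in> faces_on P"
  shows "closure X \<in> lunes (T_vee P) {0}"
  using closure_faces_bij_betw[OF assms(1)] assms(2) by (auto simp: bij_betw_def T_vee_singletons)

text \<open>The generic point of the composite lune has at every \<open>S\<close> the sign
  prescribed for the derivative, and signs determine a face. So its cell is the derivative, and the
  closure of that cell is the composite.\<close>

lemma cut_deriv_eq:
  assumes cut: "is_cut P V (R :: 'i::finite set set)" and X: "X \<in> faces_on R"
  shows "cut_deriv V X \<in> faces_on P"
    and "closure (cut_deriv V X) = lune_comp (T_vee P) {0} (closure X) (half_space V)"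
proof -
  obtain C D where s: "splits P C D R" and V: "V = cut P C D" using cut by (rule is_cutE)
  note P = is_cut_partition(1)[OF cut] and R = is_cut_partition(2)[OF cut]
  obtain l where l: "X = sign_cell (T_vee R) {0} l" "generic (T_vee R) {0} l"
    using X unfolding faces_on_eq[OF R] by blast
  obtain m :: "real^'i" where m: "generic (T_vee P) (T_vee R) m"
    "half_space (cut P C D) = sign_cone (T_vee P) (T_vee R) m"
    "\<And>S. Redn P S = C \<Longrightarrow> sgn (sum_on m S) = 1"
    "\<And>S. Redn P S = D \<Longrightarrow> sgn (sum_on m S) = - 1"
    "\<And>S. Redn P S = {} \<Longrightarrow> sgn (sum_on m S) = 0"
    using half_space_cut[OF s] by metis
  obtain n where n: "generic (T_vee P) {0} n"
    "lune_comp (T_vee P) {0} (sign_cone (T_vee R) {0} l) (sign_cone (T_vee P) (T_vee R) m) =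
      sign_cone (T_vee P) {0} n"
    "\<And>S. S \<in> vanishing (T_vee R) \<Longrightarrow> sgn (sum_on n S) = sgn (sum_on m S)"
    "\<And>S. S \<in> vanishing {0} \<Longrightarrow> S \<notin> vanishing (T_vee R) \<Longrightarrow> sgn (sum_on n S) = sgn (sum_on l S)"
    using lune_comp_eq[OF T_vee_flat[OF P] T_vee_flat[OF R] zero_flat splits_T_vee_subset[OF s]
        zero_subset_T_vee m(1) l(2)] by metis
  have vR: "S \<in> vanishing (T_vee R :: (real^'i) set) \<longleftrightarrow> Redn P S \<in> {{}, C, D}" for S
    using vanishing_T_vee_splits[OF s] .
  have nR: "S \<notin> vanishing (T_vee R :: (real^'i) set) \<longleftrightarrow> \<not> eq_mod R S {}" for S
    using vanishing_T_vee[OF R] by (simp add: eq_mod_def)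
  have eqs: "eq_mod P S C \<longleftrightarrow> Redn P S = C" "eq_mod P S D \<longleftrightarrow> Redn P S = D"
    "eq_mod P S {} \<longleftrightarrow> Redn P S = {}" for S
    using Redn_part[OF s] Redn_part[OF splits_commute[OF s]] by (simp_all add: eq_mod_def)
  let ?Y = "sign_cell (T_vee P) {0} n"
  have Y: "?Y \<in> faces_on P" using n(1) unfolding faces_on_eq[OF P] by blast
  have "cut_deriv V X = ?Y"
    unfolding cut_deriv_def V tgt_cut[OF s] src_cut[OF s] left_part_cut right_part_cut
  proof (rule the_equality)
    have "face_sign ?Y S = 1" if "eq_mod P S C" for S
      using that n(3) m(3) vR by (simp add: face_sign_sign_cell[OF n(1)] eqs)
    moreover have "face_sign ?Y S = - 1" if "eq_mod P S D" for S
      using that n(3) m(4) vR by (simp add: face_sign_sign_cell[OF n(1)] eqs)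
    moreover have "face_sign ?Y S = 0" if "eq_mod P S {}" for S
      using that n(3) m(5) vR by (simp add: face_sign_sign_cell[OF n(1)] eqs)
    moreover have "face_sign ?Y S = face_sign X S" if "\<not> eq_mod R S {}" for S
      using that n(4) nR by (simp add: face_sign_sign_cell[OF n(1)] face_sign_sign_cell[OF l(2)] l(1))
    ultimately show "?Y \<in> faces_on P \<and> (\<forall>S. (eq_mod P S C \<longrightarrow> face_sign ?Y S = 1) \<and>
        (eq_mod P S D \<longrightarrow> face_sign ?Y S = - 1) \<and>
        (\<not> eq_mod R S {} \<longrightarrow> face_sign ?Y S = face_sign X S) \<and>
        (eq_mod P S {} \<longrightarrow> face_sign ?Y S = 0))"
      using Y by blast
  next
    fix Y' assume Y': "Y' \<in> faces_on P \<and> (\<forall>S. (eq_mod P S C \<longrightarrow> face_sign Y' S = 1) \<and>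
        (eq_mod P S D \<longrightarrow> face_sign Y' S = - 1) \<and>
        (\<not> eq_mod R S {} \<longrightarrow> face_sign Y' S = face_sign X S) \<and>
        (eq_mod P S {} \<longrightarrow> face_sign Y' S = 0))"
    then obtain n' where n': "Y' = sign_cell (T_vee P) {0} n'" "generic (T_vee P) {0} n'"
      unfolding faces_on_eq[OF P] by blast
    have "sgn (sum_on n' S) = sgn (sum_on n S)" for S
    proof -
      have fs: "face_sign Y' S = sgn (sum_on n' S)" "face_sign X S = sgn (sum_on l S)"
        unfolding n'(1) l(1) using face_sign_sign_cell n'(2) l(2) by blast+
      \<comment> \<open>The cases are exhaustive: if the sum over \<open>S\<close> vanishes on
        \<open>T_vee R\<close>, then \<open>S\<close> is \<open>C\<close>, \<open>D\<close> or empty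
        modulo \<open>P\<close>. Hence the prescribed signs leave no choice.\<close>
      consider "eq_mod P S C" | "eq_mod P S D" | "eq_mod P S {}" | "\<not> eq_mod R S {}"
        using vR[of S] nR[of S] eqs by blast
      then show ?thesis
      proof cases
        case 1
        then show ?thesis using Y' fs n(3)[of S] m(3)[of S] vR[of S] eqs by simp
      next
        case 2
        then show ?thesis using Y' fs n(3)[of S] m(4)[of S] vR[of S] eqs by simp
      next
        case 3
        then show ?thesis using Y' fs n(3)[of S] m(5)[of S] vR[of S] eqs by simp
      next
        case 4
        then show ?thesis using Y' fs n(4)[of S] nR[of S] by simp
      qed
    qed
    then show "Y' = ?Y" unfolding n'(1) by (intro sign_cell_cong)
  qed
  then show "cut_deriv V X \<in> faces_on P"
    "closure (cut_deriv V X) = lune_comp (T_vee P) {0} (closure X) (half_space V)"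
    using Y n(2) by (simp_all add: V m(2) l(1) closure_sign_cell subspace_T_vee l(2) n(1))
qed

section \<open>Chains of cuts\<close>

lemma is_cut_T_vee_subset:
  assumes "is_cut P V (R :: 'i::finite set set)"
  shows "T_vee R \<subseteq> (T_vee P :: (real^'i) set)"
proof -
  obtain C D where "splits P C D R" using assms by (rule is_cutE)
  then show ?thesis by (rule splits_T_vee_subset)
qed

lemma is_cut_tgt: "is_cut P V (R :: 'i::finite set set) \<Longrightarrow> tgt V = P"
  by (auto simp: is_cut_def layered_forest_iff)

lemma pi_cuts_mem_lunes:
  fixes P :: "'i::finite set set"
  assumes "cut_chain P Vs Q" "partition_on UNIV Q"
  shows "(pi_cuts Q Vs :: (real^'i) set) \<in> lunes (T_vee P) (T_vee Q) \<and> T_vee Q \<subseteq> (T_vee P :: (real^'i) set)"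
  using assms(1)
proof (induction Vs arbitrary: P)
  case Nil
  then show ?case using flat_mem_lunes[OF T_vee_flat[OF assms(2)]] by simp
next
  case (Cons V Vs)
  then obtain R where R: "is_cut P V R" "cut_chain R Vs Q" by auto
  note part = is_cut_partition[OF R(1)] and IH = Cons.IH[OF R(2)]
  have "lune_comp (T_vee P) (T_vee Q) (pi_cuts Q Vs) (half_space V) \<in> lunes (T_vee P :: (real^'i) set) (T_vee Q)"
    using IH is_cut_T_vee_subset[OF R(1)] half_space_mem_lunes[OF R(1)]
    by (intro lune_comp_mem_lunes[of _ "T_vee R"] T_vee_flat part assms(2)) auto
  then show ?case using is_cut_tgt[OF R(1)] IH is_cut_T_vee_subset[OF R(1)] by auto
qed

text \<open>The derivative composes the face with one half-space at a time, from the last cut to the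
  first, whereas \<open>pi_cuts\<close> composes the half-spaces among themselves; one use of
  associativity per cut reconciles the two.\<close>

lemma foldr_cut_deriv:
  fixes P :: "'i::finite set set"
  assumes "cut_chain P Vs Q" "partition_on UNIV Q" "X \<in> faces_on Q"
  shows "foldr cut_deriv Vs X \<in> faces_on P \<and>
    closure (foldr cut_deriv Vs X) = lune_comp (T_vee P) {0} (closure X) (pi_cuts Q Vs)"
  using assms(1)
proof (induction Vs arbitrary: P)
  case Nil
  have "closure X \<in> lunes (T_vee Q) {0}" using assms(2,3) by (rule closure_face_mem_lunes)
  then show ?case using Nil assms(3)
      lune_comp_flat_right[OF T_vee_flat[OF assms(2)] zero_flat zero_subset_T_vee] by simp
next
  case (Cons V Vs)
  then obtain R where R: "is_cut P V R" "cut_chain R Vs Q" by auto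
  note part = is_cut_partition[OF R(1)] and IH = Cons.IH[OF R(2)]
    and pi = pi_cuts_mem_lunes[OF R(2) assms(2)]
  have "lune_comp (T_vee P) {0} (lune_comp (T_vee R) {0} (closure X) (pi_cuts Q Vs)) (half_space V) =
      lune_comp (T_vee P) {0} (closure X) (lune_comp (T_vee P) (T_vee Q) (pi_cuts Q Vs) (half_space V))"
    using pi half_space_mem_lunes[OF R(1)] closure_face_mem_lunes[OF assms(2,3)]
      is_cut_T_vee_subset[OF R(1)]
    by (intro lune_comp_assoc[of _ "T_vee R" "T_vee Q"] T_vee_flat part assms(2) zero_flat zero_subset_T_vee) auto
  then show ?case using cut_deriv_eq[OF R(1)] IH is_cut_tgt[OF R(1)] by simp
qed

lemma forest_deriv_eq:
  fixes P :: "'i::finite set set"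
  assumes "layered_forest P F Q" "X \<in> faces_on Q"
  shows "forest_deriv F X \<in> faces_on P"
    and "closure (forest_deriv F X) = lune_comp (T_vee P) (T_vee singletons) (closure X) (pi_forest F)"
proof -
  have "partition_on UNIV Q" "src F = Q" using assms(1) by (simp_all add: layered_forest_iff)
  then show "forest_deriv F X \<in> faces_on P"
    "closure (forest_deriv F X) = lune_comp (T_vee P) (T_vee singletons) (closure X) (pi_forest F)"
    using foldr_cut_deriv[OF cuts_of_cut_chain(1)[OF assms(1)] _ assms(2)]
    by (simp_all add: forest_deriv_def pi_forest_def T_vee_singletons)
qed

text \<open>Read off from the factorization rather than from the trees: replacing cuts of a chain by
  their opposites gives a chain between the same partitions.\<close>

lemma layered_forest_switch:
  fixes P :: "'i::finite set set"
  assumes "layered_forest P F Q"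
  shows "layered_forest P (switch W ` F) Q"
proof -
  have part: "partition_on UNIV Q" using assms by (simp add: layered_forest_iff)
  note c = cuts_of_cut_chain[OF assms]
  have "switch W ` F = foldr forest_comp (switch_cuts W (cuts_of F)) (forest_id Q)"
    using switch_foldr_forest_comp[OF c(1) part] c(2) by simp
  then show ?thesis
    using cut_chain_layered_forest[OF cut_chain_switch_cuts[OF c(1)] part] by simp
qed

section \<open>The action on faces\<close>

text \<open>Subsets are sorted by whether they contain 0, not the largest element, because peeling
  off the first cut lowers the remaining ranks by one.\<close>

lemma sum_Pow_lessThan_Suc:
  "(\<Sum>W\<in>Pow {..<Suc n}. f W) = (\<Sum>W\<in>Pow {..<n}. f (Suc ` W) + f (insert 0 (Suc ` W)))"
proof -
  have inj: "inj_on ((`) Suc) A" "inj_on (\<lambda>W. insert 0 (Suc ` W)) A" for A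
    by (auto simp: inj_on_def inj_image_eq_iff dest!: insert_ident[THEN iffD1, rotated 2])
  have "Pow {..<Suc n} = (`) Suc ` Pow {..<n} \<union> (\<lambda>W. insert 0 (Suc ` W)) ` Pow {..<n}"
    by (simp add: lessThan_Suc_eq_insert_0 Pow_insert image_Pow_surj[OF refl] image_image
        flip: image_image[of "insert 0" "(`) Suc"])
  moreover have "(`) Suc ` Pow {..<n} \<inter> (\<lambda>W. insert 0 (Suc ` W)) ` Pow {..<n} = {}" by auto
  ultimately show ?thesis
    by (simp add: sum.union_disjoint sum.reindex[OF inj(1)] sum.reindex[OF inj(2)] sum.distrib)
qed

text \<open>Multiplying out: each operator offers a cut or its opposite, \<open>W\<close> records
  the positions where the opposite is taken, and each of these contributes a factor -1.\<close>

lemma foldr_dual_cut_deriv: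
  "foldr dual_cut_deriv Vs x = lin_ext (\<lambda>X. \<Sum>W\<in>Pow {..<length Vs}.
    Poly_Mapping.single (foldr cut_deriv (switch_cuts W Vs) X) ((- 1) ^ card W)) x"
proof (induction Vs)
  case Nil
  show ?case by simp
next
  case (Cons V Vs)
  have step: "(\<Sum>W\<in>Pow {..<length Vs}. dual_cut_deriv V
      (Poly_Mapping.single (foldr cut_deriv (switch_cuts W Vs) X) ((- 1) ^ card W))) =
    (\<Sum>W\<in>Pow {..<length (V # Vs)}.
      Poly_Mapping.single (foldr cut_deriv (switch_cuts W (V # Vs)) X) ((- 1) ^ card W))" for X
  proof -
    \<comment> \<open>The set without 0 keeps \<open>V\<close>; the one with 0 takes the opposite
      cut and has one element more, which accounts for the minus sign.\<close>
    have "dual_cut_deriv V (Poly_Mapping.single (foldr cut_deriv (switch_cuts W Vs) X) ((- 1) ^ card W)) =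
      Poly_Mapping.single (foldr cut_deriv (switch_cuts (Suc ` W) (V # Vs)) X) ((- 1) ^ card (Suc ` W)) +
      Poly_Mapping.single (foldr cut_deriv (switch_cuts (insert 0 (Suc ` W)) (V # Vs)) X)
        ((- 1) ^ card (insert 0 (Suc ` W)))" if "W \<in> Pow {..<length Vs}" for W
    proof -
      have fin: "finite W" using that by (auto intro: finite_subset)
      have "{n. Suc n \<in> Suc ` W} = W" "card (Suc ` W) = card W"
        "card (insert 0 (Suc ` W)) = Suc (card W)"
        using fin by (auto simp: card_image)
      then show ?thesis
        by (simp add: dual_cut_deriv_def)
          (rule poly_mapping_eqI, simp add: lookup_add lookup_minus lookup_single when_def)
    qed
    then show ?thesis unfolding length_Cons sum_Pow_lessThan_Suc by (intro sum.cong) auto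
  qed
  have "foldr dual_cut_deriv (V # Vs) x = lin_ext (\<lambda>X. \<Sum>W\<in>Pow {..<length Vs}. dual_cut_deriv V
      (Poly_Mapping.single (foldr cut_deriv (switch_cuts W Vs) X) ((- 1) ^ card W))) x"
    by (simp add: Cons.IH dual_cut_deriv_def[of V] lin_ext_lin_ext lin_ext_sum)
  then show ?case unfolding step .
qed

section \<open>Linear maps between the spaces of faces\<close>

lemma keys_sum_subset:
  assumes "\<And>a. a \<in> A \<Longrightarrow> Poly_Mapping.keys (f a) \<subseteq> B"
  shows "Poly_Mapping.keys (\<Sum>a\<in>A. f a) \<subseteq> B"
  using assms
proof (induction A rule: infinite_finite_induct)
  case (insert a A)
  then show ?case using keys_add[of "f a" "\<Sum>a\<in>A. f a"] by (simp, blast)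
qed auto

text \<open>A combination of lunes serves both functors at once: a one-element \<open>J\<close>
  gives a single forest, and \<open>J\<close> consisting of the sets of switched nodes gives the
  alternating sum.\<close>

lemma Hom_zero_face_lune:
  assumes x: "x \<in> L_vee Q"
    and d: "\<And>W X. W \<in> J \<Longrightarrow> X \<in> faces_on Q \<Longrightarrow>
      closure (d W X) = lune_comp A (T_vee singletons) (closure X) (M W)"
  shows "Hom_zero A (\<Sum>W\<in>J. Poly_Mapping.single (M W) (c W)) (face_lune x) =
    face_lune (lin_ext (\<lambda>X. \<Sum>W\<in>J. Poly_Mapping.single (d W X) (c W)) x)"
  unfolding Hom_zero_def Ass_comp_def face_lune_def lin_ext_lin_ext
  using x by (intro lin_ext_cong) (auto simp: L_vee_def lin_ext_sum d intro!: sum.cong)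

lemma face_lune_bij_betw:
  assumes "partition_on UNIV (P :: 'i::finite set set)"
  shows "bij_betw face_lune (L_vee P :: ((real^'i) set \<Rightarrow>\<^sub>0 'k::field) set)
    (Ass_hom (T_vee P) (T_vee singletons))"
  using lin_ext_single_bij_betw[OF closure_faces_bij_betw[OF assms]]
  by (simp add: L_vee_def Ass_hom_def face_lune_def[abs_def])

lemma pi_functor_forest:
  fixes P :: "'i::finite set set" and x :: "(real^'i) set \<Rightarrow>\<^sub>0 'k::field"
  assumes L: "layered_forest P F Q" and x: "x \<in> L_vee Q"
  shows "forest_deriv_map F x \<in> L_vee P"
    and "Hom_zero (T_vee P) (pi_functor (Poly_Mapping.single F 1)) (face_lune x) =
      face_lune (forest_deriv_map F x)"
proof -
  have "Poly_Mapping.keys (forest_deriv_map F x) \<subseteq> faces_on P"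
    unfolding forest_deriv_map_def
    using x forest_deriv_eq(1)[OF L] by (intro keys_lin_ext) (auto simp: L_vee_def)
  then show "forest_deriv_map F x \<in> L_vee P" by (simp add: L_vee_def)
  show "Hom_zero (T_vee P) (pi_functor (Poly_Mapping.single F 1)) (face_lune x) =
      face_lune (forest_deriv_map F x)"
    using Hom_zero_face_lune[OF x, of "{()}" "\<lambda>_. forest_deriv F" "T_vee P" "\<lambda>_. pi_forest F" "\<lambda>_. 1"]
      forest_deriv_eq(2)[OF L]
    by (simp add: pi_functor_def forest_deriv_map_def)
qed

lemma dual_forest_deriv_eq:
  fixes P :: "'i::finite set set"
  assumes "layered_forest P F Q"
  shows "dual_forest_deriv F x = lin_ext (\<lambda>X. \<Sum>W\<in>Pow {..<num_nodes F}.
    Poly_Mapping.single (forest_deriv (switch W ` F) X) ((- 1) ^ card W)) x"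
  by (simp add: dual_forest_deriv_def foldr_dual_cut_deriv forest_deriv_def
      length_cuts_of[OF assms] cuts_of_switch[OF assms])

lemma pi_functor_A_functor_forest:
  fixes P :: "'i::finite set set" and x :: "(real^'i) set \<Rightarrow>\<^sub>0 'k::field"
  assumes L: "layered_forest P F Q" and x: "x \<in> L_vee Q"
  shows "dual_forest_deriv F x \<in> L_vee P"
    and "Hom_zero (T_vee P) (pi_functor (A_functor (Poly_Mapping.single F 1))) (face_lune x) =
      face_lune (dual_forest_deriv F x)"
proof -
  note W = layered_forest_switch[OF L]
  have "Poly_Mapping.keys (dual_forest_deriv F x) \<subseteq> faces_on P"
    unfolding dual_forest_deriv_eq[OF L]
    using x forest_deriv_eq(1)[OF W] by (intro keys_lin_ext keys_sum_subset) (auto simp: L_vee_def)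
  then show "dual_forest_deriv F x \<in> L_vee P" by (simp add: L_vee_def)
  show "Hom_zero (T_vee P) (pi_functor (A_functor (Poly_Mapping.single F 1))) (face_lune x) =
      face_lune (dual_forest_deriv F x)"
    using Hom_zero_face_lune[OF x, of "Pow {..<num_nodes F}" "\<lambda>W. forest_deriv (switch W ` F)" "T_vee P"
        "\<lambda>W. pi_forest (switch W ` F)" "\<lambda>W. (- 1) ^ card W"] forest_deriv_eq(2)[OF W]
    by (simp add: pi_functor_def A_functor_def alternating_forest_def lin_ext_sum dual_forest_deriv_eq[OF L])
qed

theorem mainTheorem7:
  shows
    "(\<forall>P :: 'i::finite set set. partition_on UNIV P \<longrightarrow>
        bij_betw face_lune (L_vee P :: ((real^'i) set \<Rightarrow>\<^sub>0 'k::field_char_0) set)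
          (Ass_hom (T_vee P) (T_vee singletons)))
   \<and> (\<forall>(P :: 'i::finite set set) Q V X. is_cut P V Q \<longrightarrow> X \<in> faces_on Q \<longrightarrow>
        cut_deriv V X \<in> faces_on P \<and>
        closure (cut_deriv V X)
          = lune_comp (T_vee P) (T_vee singletons) (closure X) (pi_forest V))
   \<and> (\<forall>(P :: 'i::finite set set) Q F. layered_forest P F Q \<longrightarrow>
        (\<forall>x \<in> (L_vee Q :: ((real^'i) set \<Rightarrow>\<^sub>0 'k::field_char_0) set).
           forest_deriv_map F x \<in> L_vee P \<and>
           Hom_zero (T_vee P) (pi_functor (Poly_Mapping.single F 1)) (face_lune x)
             = face_lune (forest_deriv_map F x)) \<and>
        (\<forall>x \<in> (L_vee Q :: ((real^'i) set \<Rightarrow>\<^sub>0 'k::field_char_0) set).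
           dual_forest_deriv F x \<in> L_vee P \<and>
           Hom_zero (T_vee P) (pi_functor (A_functor (Poly_Mapping.single F 1))) (face_lune x)
             = face_lune (dual_forest_deriv F x)))"
proof (intro conjI allI impI ballI)
  fix P Q :: "'i set set" and V and X :: "(real^'i) set"
  assume cut: "is_cut P V Q" and X: "X \<in> faces_on Q"
  have L: "layered_forest P V Q" using cut by (simp add: is_cut_def)
  \<comment> \<open>A cut is its own factorization, so the claim for one cut is an instance of the
    one for forests.\<close>
  have eq: "forest_deriv V X = cut_deriv V X"
    by (simp add: forest_deriv_def cuts_of_is_cut[OF cut])
  show "cut_deriv V X \<in> faces_on P"
    "closure (cut_deriv V X) = lune_comp (T_vee P) (T_vee singletons) (closure X) (pi_forest V)"
    using forest_deriv_eq[OF L X] by (simp_all add: eq)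
qed (rule face_lune_bij_betw pi_functor_forest pi_functor_A_functor_forest; assumption)+

end
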